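(* For $a=1,2$ and $1\le i,j\le q$, let $\sigma^2(\widehat u_{a,ij})$ be the variance of the U-statistic $\widehat u_{a,ij}$ and $\widehat\sigma^2(\widehat u_{a,ij})$ its Jackknife variance estimator (see context). Then $m^2\zeta_{a,ij}$ is the limit of $n_a\sigma^2(\widehat u_{a,ij})$ as $n_a\to\infty$, and $m^2\zeta_{a,ij}$ is also the limit (in probability) of $n_a\widehat\sigma^2(\widehat u_{a,ij})$ as $n_a\to\infty$. Moreover, suppose that $n_1\asymp n_2\asymp n$, that $\log q=O(n^{1/3-\epsilon})$ for some (arbitrary) $0<\epsilon<1/3$, and that $\zeta_{a,ij}>r_a>0$ for $a=1,2$ and all $1\le i,j\le q$, with constants $r_1,r_2$ not depending on $i,j$. Then there are a constant $C$ and a sequence $\varepsilon_n=o(1)$ such that, as $n,q\to\infty$, for $a=1,2$, $$\mathbb P\Big(\max_{1\le i,j\le q}\big|n_a\widehat\sigma^2(\widehat u_{a,ij})-m^2\zeta_{a,ij}\big|\ge C\frac{\varepsilon_n}{\log q}\Big)=o(1).$$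
   Context: Setting. $\boldsymbol X,\boldsymbol Y$ are random vectors in $\mathbb R^d$; $\boldsymbol X_1,\dots,\boldsymbol X_{n_1}$ are i.i.d. copies of $\boldsymbol X$ and $\boldsymbol Y_1,\dots,\boldsymbol Y_{n_2}$ are i.i.d. copies of $\boldsymbol Y$; $n:=\max\{n_1,n_2\}$. For $1\le i,j\le q$, $\Phi_{ij}:(\mathbb R^d)^m\to\mathbb R$ is a Borel kernel, symmetric in its $m$ arguments, with $\Phi_{ij}=\Phi_{ji}$, fixed order $m$, and bounded uniformly in $i,j$ (and along the asymptotic sequence). In the statement with $n,q\to\infty$, the quantities $n_1,n_2,d,q$, the laws and the kernels may vary along the sequence, with the constants in the assumption fixed; the first two limits are for a fixed law and kernel. $\widehat u_{1,ij}=\binom{n_1}{m}^{-1}\sum_{1\le \ell_1<\dots<\ell_m\le n_1}\Phi_{ij}(\boldsymbol X_{\ell_1},\dots,\boldsymbol X_{\ell_m})$, and $\widehat u_{2,ij}$ is the same with $\boldsymbol Y$, $n_2$. Jackknife variance estimator: $\widehat\sigma^2(\widehat u_{1,ij})=\frac{m^2(n_1-1)}{n_1(n_1-m)^2}\sum_{\alpha=1}^{n_1}(q_{1\alpha,ij}-\widehat u_{1,ij})^2$ with $q_{1\alpha,ij}=\binom{n_1-1}{m-1}^{-1}\sum \Phi_{ij}(\boldsymbol X_\alpha,\boldsymbol X_{\ell_1},\dots,\boldsymbol X_{\ell_{m-1}})$, the sum over $1\le \ell_1<\dots<\ell_{m-1}\le n_1$ with all $\ell_k\ne\alpha$; $\widehat\sigma^2(\widehat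 u_{2,ij})$ is defined analogously from $\boldsymbol Y$, $n_2$. $\zeta_{1,ij}=\mathrm{Var}\big(\mathbb E[\Phi_{ij}(\boldsymbol X_1,\dots,\boldsymbol X_m)\mid\boldsymbol X_1]\big)$, $\zeta_{2,ij}=\mathrm{Var}\big(\mathbb E[\Phi_{ij}(\boldsymbol Y_1,\dots,\boldsymbol Y_m)\mid\boldsymbol Y_1]\big)$. *)

theory Defs
  imports
    "HOL-Probability.Probability"
    "HOL-Combinatorics.Permutations"
    "HOL-Library.Landau_Symbols"
begin

(* The dimension d varies along the asymptotic sequence, so it cannot be a type.  A point of
   R^d is an extensional function on {1..d}; the product sigma-algebra below is the Borel
   sigma-algebra of R^d.  A point of (R^d)^m is an extensional function on {1..m}. *)
definition Rd :: "nat \<Rightarrow> (nat \<Rightarrow> real) measure" where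
  "Rd d = PiM {1..d} (\<lambda>_. borel)"

definition Rdm :: "nat \<Rightarrow> nat \<Rightarrow> (nat \<Rightarrow> nat \<Rightarrow> real) measure" where
  "Rdm d m = PiM {1..m} (\<lambda>_. Rd d)"

(* Kernels are compared and constrained only on (R^d)^m, i.e. on space (Rdm d m). *)
definition symmetric_kernel ::
    "nat \<Rightarrow> nat \<Rightarrow> ((nat \<Rightarrow> nat \<Rightarrow> real) \<Rightarrow> real) \<Rightarrow> bool" where
  "symmetric_kernel d m \<Phi> \<longleftrightarrow>
     \<Phi> \<in> borel_measurable (Rdm d m) \<and>
     (\<forall>\<pi>. \<pi> permutes {1..m} \<longrightarrow> (\<forall>x\<in>space (Rdm d m). \<Phi> (x \<circ> \<pi>) = \<Phi> x))"

definition kernel_family ::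
    "nat \<Rightarrow> nat \<Rightarrow> nat \<Rightarrow> real \<Rightarrow> (nat \<Rightarrow> nat \<Rightarrow> (nat \<Rightarrow> nat \<Rightarrow> real) \<Rightarrow> real) \<Rightarrow> bool" where
  "kernel_family d m q B \<Phi> \<longleftrightarrow>
     (\<forall>i\<in>{1..q}. \<forall>j\<in>{1..q}. symmetric_kernel d m (\<Phi> i j) \<and>
        (\<forall>x\<in>space (Rdm d m). \<Phi> i j x = \<Phi> j i x \<and> \<bar>\<Phi> i j x\<bar> \<le> B))"

(* P is the common law of the vectors X l, l in I. *)
definition iid_copies ::
    "'w measure \<Rightarrow> nat \<Rightarrow> (nat \<Rightarrow> real) measure \<Rightarrow> nat set \<Rightarrow> (nat \<Rightarrow> 'w \<Rightarrow> nat \<Rightarrow> real) \<Rightarrow> bool" where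
  "iid_copies M d P I X \<longleftrightarrow>
     prob_space.indep_vars M (\<lambda>_. Rd d) X I \<and> (\<forall>l\<in>I. distr M (Rd d) (X l) = P)"

definition incr_tuples :: "nat \<Rightarrow> nat set \<Rightarrow> (nat \<Rightarrow> nat) set" where
  "incr_tuples m A = {l \<in> {1..m} \<rightarrow>\<^sub>E A. strict_mono_on {1..m} l}"

definition ustat ::
    "nat \<Rightarrow> nat \<Rightarrow> ((nat \<Rightarrow> nat \<Rightarrow> real) \<Rightarrow> real) \<Rightarrow> (nat \<Rightarrow> 'w \<Rightarrow> nat \<Rightarrow> real) \<Rightarrow> 'w \<Rightarrow> real" where
  "ustat m n \<Phi> X \<omega> =
     (\<Sum>l\<in>incr_tuples m {1..n}. \<Phi> (\<lambda>k\<in>{1..m}. X (l k) \<omega>)) / real (n choose m)"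

definition jack_comp ::
    "nat \<Rightarrow> nat \<Rightarrow> ((nat \<Rightarrow> nat \<Rightarrow> real) \<Rightarrow> real) \<Rightarrow> (nat \<Rightarrow> 'w \<Rightarrow> nat \<Rightarrow> real) \<Rightarrow> nat \<Rightarrow> 'w \<Rightarrow> real" where
  "jack_comp m n \<Phi> X \<alpha> \<omega> =
     (\<Sum>l\<in>incr_tuples (m - 1) ({1..n} - {\<alpha>}).
        \<Phi> (\<lambda>k\<in>{1..m}. if k = 1 then X \<alpha> \<omega> else X (l (k - 1)) \<omega>))
     / real ((n - 1) choose (m - 1))"

definition jack_var ::
    "nat \<Rightarrow> nat \<Rightarrow> ((nat \<Rightarrow> nat \<Rightarrow> real) \<Rightarrow> real) \<Rightarrow> (nat \<Rightarrow> 'w \<Rightarrow> nat \<Rightarrow> real) \<Rightarrow> 'w \<Rightarrow> real" where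
  "jack_var m n \<Phi> X \<omega> =
     (real m)\<^sup>2 * (real n - 1) / (real n * (real n - real m)\<^sup>2) *
     (\<Sum>\<alpha>=1..n. (jack_comp m n \<Phi> X \<alpha> \<omega> - ustat m n \<Phi> X \<omega>)\<^sup>2)"

(* Var(E[Phi(X_1,...,X_m) | X_1]), conditioning on the sigma-algebra generated by X_1. *)
definition zeta ::
    "'w measure \<Rightarrow> nat \<Rightarrow> nat \<Rightarrow> ((nat \<Rightarrow> nat \<Rightarrow> real) \<Rightarrow> real) \<Rightarrow> (nat \<Rightarrow> 'w \<Rightarrow> nat \<Rightarrow> real) \<Rightarrow> real" where
  "zeta M d m \<Phi> X =
     prob_space.variance M
       (real_cond_exp M (vimage_algebra (space M) (X 1) (Rd d))
          (\<lambda>\<omega>. \<Phi> (\<lambda>k\<in>{1..m}. X k \<omega>)))"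

definition tendsto_in_prob :: "'w measure \<Rightarrow> (nat \<Rightarrow> 'w \<Rightarrow> real) \<Rightarrow> real \<Rightarrow> bool" where
  "tendsto_in_prob M T c \<longleftrightarrow>
     (\<forall>\<delta>>0. (\<lambda>n. measure M {\<omega> \<in> space M. \<bar>T n \<omega> - c\<bar> \<ge> \<delta>}) \<longlonglongrightarrow> 0)"

end

theory Submission
  imports Defs "HOL-Real_Asymp.Real_Asymp"
begin

text \<open>
  Write \<open>W S\<close> for the kernel evaluated at the sample points with index in the \<open>m\<close>-set \<open>S\<close>, and
  put \<open>\<theta> = E (W S)\<close> and \<open>\<gamma> = E (W S * W T)\<close> for \<open>|S \<inter> T| = 1\<close>. By Fubini \<open>\<zeta> = \<gamma> - \<theta>\<^sup>2\<close>.
  In the variance of the U-statistic the pairs with \<open>S \<inter> T = {}\<close> contribute nothing, the pairs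
  meeting once contribute \<open>\<zeta>\<close> each, and all others have a share \<open>O(1/n\<^sup>2)\<close>.

  Since the \<open>q\<^sub>\<alpha>\<close> average to \<open>u\<close>, the jackknife estimator times \<open>n\<close> is, up to a deterministic error
  \<open>O(1/n)\<close>, \<open>m\<^sup>2\<close> times \<open>Q - u\<^sup>2\<close>, where \<open>Q\<close> averages \<open>W (R \<union> {a}) * W (R' \<union> {a})\<close> over disjoint
  \<open>{a}\<close>, \<open>R\<close>, \<open>R'\<close>. Both \<open>u\<close> and \<open>Q\<close> are averages, over all permutations of the sample, of means
  of \<open>n div (2m - 1)\<close> independent bounded terms; convexity of exp transfers Hoeffding's bound to them.
  The resulting tail \<open>exp (- c n \<tau>\<^sup>2)\<close> beats the \<open>q\<^sup>2\<close> terms of the union bound for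
  \<open>\<tau> = n powr (- \<epsilon>) / ln q\<close>, because \<open>(ln q) ^ 3 = O(n powr (1 - 3 * \<epsilon>))\<close>.
\<close>

section \<open>Averages over permutations\<close>

text \<open>Rewriting a statistic as an average over permutations requires its index set to be a
  single orbit. Squaring \<open>q\<^sub>\<alpha>\<close> produces pairs \<open>R\<close>,
  \<open>R'\<close> with every size of overlap, hence summands with different means; this is why
  only disjoint pairs are kept. The pairs dropped are a fraction of order 1/n, the same order as the
  error of the prefactor. A remaining triple occupies 1 + 2 (m - 1) sample points, which is where
  the block length \<open>2 * m - 1\<close> comes from. Sums are indexed by sets instead of
  increasing tuples because a permutation destroys the order of a tuple but maps m-sets to m-sets;
  the symmetry of the kernel makes its value on a set well defined. The exponent 1/3 comes from the
  scale 1 / ln q: with \<tau> = n powr (-\<epsilon>) / ln q, the requirement that n \<tau>^2 exceed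
  a multiple of ln q reads (ln q)^3 \<le> const * n powr (1 - 2 \<epsilon>), and the growth
  condition meets it with a factor n powr \<epsilon> to spare, which absorbs every constant.\<close>

lemma average_over_permutations:
  fixes act :: "('a \<Rightarrow> 'a) \<Rightarrow> 't \<Rightarrow> 't" and G :: "'t \<Rightarrow> real"
  assumes A: "finite A" and T: "finite T"
    and inj: "\<And>\<pi>. \<pi> permutes A \<Longrightarrow> inj_on (act \<pi>) T"
    and into: "\<And>\<pi> t. \<pi> permutes A \<Longrightarrow> t \<in> T \<Longrightarrow> act \<pi> t \<in> T"
    and comp: "\<And>\<pi> \<sigma> t. act (\<pi> \<circ> \<sigma>) t = act \<pi> (act \<sigma> t)"
    and trans: "\<And>s t. s \<in> T \<Longrightarrow> t \<in> T \<Longrightarrow> \<exists>\<sigma>. \<sigma> permutes A \<and> act \<sigma> s = t"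
    and s: "s \<in> T"
  shows "(\<Sum>\<pi> | \<pi> permutes A. G (act \<pi> s)) / real (card {\<pi>. \<pi> permutes A}) =
    (\<Sum>t\<in>T. G t) / real (card T)"
proof -
  let ?S = "{\<pi>. \<pi> permutes A}"
  have fin: "finite ?S" using A by (rule finite_permutations)
  have "?S \<noteq> {}" using permutes_id[of A] by blast
  hence pos: "card ?S > 0" "card T > 0" using fin T s by (auto simp only: card_gt_0_iff)
  \<comment> \<open>Right composition with \<sigma> only reorders the sum over \<pi>, so by
    transitivity this sum does not depend on the base point.\<close>
  have const: "(\<Sum>\<pi>\<in>?S. G (act \<pi> t)) = (\<Sum>\<pi>\<in>?S. G (act \<pi> s))" if t: "t \<in> T" for t
  proof -
    obtain \<sigma> where \<sigma>: "\<sigma> permutes A" "act \<sigma> s = t" using trans[OF s t] by blast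
    have "(\<Sum>\<pi>\<in>?S. G (act \<pi> s)) = (\<Sum>\<pi>\<in>?S. G (act (\<pi> \<circ> \<sigma>) s))"
      using sum_permutations_compose_right[OF \<sigma>(1)] by simp
    thus ?thesis by (simp add: comp \<sigma>)
  qed
  \<comment> \<open>Double counting over pairs of \<open>t\<close> and \<pi>: the inner sum is
    constant in \<open>t\<close> by \<open>const\<close>, and after the swap constant in \<pi>
    because \<open>act \<pi>\<close> is a bijection of \<open>T\<close>.\<close>
  have "real (card T) * (\<Sum>\<pi>\<in>?S. G (act \<pi> s)) = (\<Sum>t\<in>T. \<Sum>\<pi>\<in>?S. G (act \<pi> t))"
    by (simp add: const)
  also have "\<dots> = (\<Sum>\<pi>\<in>?S. \<Sum>t\<in>T. G (act \<pi> t))" by (rule sum.swap)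
  also have "\<dots> = (\<Sum>\<pi>\<in>?S. \<Sum>t\<in>T. G t)"
  proof (rule sum.cong[OF refl])
    fix \<pi> assume "\<pi> \<in> ?S"
    hence \<pi>: "\<pi> permutes A" by simp
    have "act \<pi> ` T = T"
      by (rule endo_inj_surj[OF T _ inj[OF \<pi>]]) (use into[OF \<pi>] in auto)
    thus "(\<Sum>t\<in>T. G (act \<pi> t)) = (\<Sum>t\<in>T. G t)"
      using sum.reindex[OF inj[OF \<pi>], of G] by simp
  qed
  also have "\<dots> = real (card ?S) * (\<Sum>t\<in>T. G t)" by simp
  finally show ?thesis using pos by (simp add: field_simps)
qed

text \<open>The complements of \<open>X\<close> and \<open>Y\<close> in the finite set
  \<open>A\<close> have equal size, so any bijection between them completes
  \<open>f\<close>.\<close>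

lemma permutes_extends_bij:
  assumes A: "finite A" and X: "X \<subseteq> A" and Y: "Y \<subseteq> A" and f: "bij_betw f X Y"
  shows "\<exists>\<pi>. \<pi> permutes A \<and> (\<forall>x\<in>X. \<pi> x = f x)"
proof -
  have "card (A - X) = card (A - Y)"
    using A X Y bij_betw_same_card[OF f] by (simp add: card_Diff_subset finite_subset)
  then obtain g where g: "bij_betw g (A - X) (A - Y)"
    using A finite_same_card_bij[of "A - X" "A - Y"] by auto
  define \<pi> where "\<pi> = (\<lambda>x. if x \<in> X then f x else if x \<in> A then g x else x)"
  have 1: "bij_betw \<pi> X Y" using f by (rule bij_betw_cong[THEN iffD1, rotated]) (simp add: \<pi>_def)
  have 2: "bij_betw \<pi> (A - X) (A - Y)"
    using g by (rule bij_betw_cong[THEN iffD1, rotated]) (simp add: \<pi>_def)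
  have "bij_betw \<pi> (X \<union> (A - X)) (Y \<union> (A - Y))"
    by (rule bij_betw_combine[OF 1 2]) auto
  hence "bij_betw \<pi> A A" using X Y by (simp add: Un_absorb1)
  moreover have "\<pi> x = x" if "x \<notin> A" for x using that X by (auto simp: \<pi>_def)
  ultimately have "\<pi> permutes A" by (rule bij_imp_permutes)
  thus ?thesis by (auto simp: \<pi>_def)
qed

text \<open>Supplies transitivity for both index sets: a triple is treated as the three sets
  \<open>{a}\<close>, \<open>R\<close>, \<open>R'\<close>, and a single subset is padded with two
  empty sets.\<close>

lemma permutes_maps_disjoint:
  assumes A: "finite A"
    and X: "X1 \<subseteq> A" "X2 \<subseteq> A" "X3 \<subseteq> A" "X1 \<inter> X2 = {}" "(X1 \<union> X2) \<inter> X3 = {}"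
    and Y: "Y1 \<subseteq> A" "Y2 \<subseteq> A" "Y3 \<subseteq> A" "Y1 \<inter> Y2 = {}" "(Y1 \<union> Y2) \<inter> Y3 = {}"
    and c: "card X1 = card Y1" "card X2 = card Y2" "card X3 = card Y3"
  shows "\<exists>\<pi>. \<pi> permutes A \<and> \<pi> ` X1 = Y1 \<and> \<pi> ` X2 = Y2 \<and> \<pi> ` X3 = Y3"
proof -
  have fin: "finite X1" "finite X2" "finite X3" "finite Y1" "finite Y2" "finite Y3"
    using X(1-3) Y(1-3) by (auto intro: finite_subset[OF _ A])
  obtain f1 f2 f3 where f: "bij_betw f1 X1 Y1" "bij_betw f2 X2 Y2" "bij_betw f3 X3 Y3"
    using finite_same_card_bij[OF fin(1,4) c(1)] finite_same_card_bij[OF fin(2,5) c(2)]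
      finite_same_card_bij[OF fin(3,6) c(3)] by blast
  define f where "f = (\<lambda>x. if x \<in> X1 then f1 x else if x \<in> X2 then f2 x else f3 x)"
  have 1: "bij_betw f X1 Y1" using f(1)
    by (rule bij_betw_cong[THEN iffD1, rotated]) (simp add: f_def)
  have 2: "bij_betw f X2 Y2" using f(2)
    by (rule bij_betw_cong[THEN iffD1, rotated]) (use X in \<open>auto simp: f_def\<close>)
  have 3: "bij_betw f X3 Y3" using f(3)
    by (rule bij_betw_cong[THEN iffD1, rotated]) (use X in \<open>auto simp: f_def\<close>)
  have "bij_betw f (X1 \<union> X2 \<union> X3) (Y1 \<union> Y2 \<union> Y3)"
    by (intro bij_betw_combine 1 2 3 Y)
  then obtain \<pi> where \<pi>: "\<pi> permutes A" "\<And>x. x \<in> X1 \<union> X2 \<union> X3 \<Longrightarrow> \<pi> x = f x"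
    using permutes_extends_bij[OF A, of "X1 \<union> X2 \<union> X3" "Y1 \<union> Y2 \<union> Y3" f] X Y by auto
  have img: "\<pi> ` Z = f ` Z" if "Z \<subseteq> X1 \<union> X2 \<union> X3" for Z
    using that \<pi>(2) by (intro image_cong) auto
  have "\<pi> ` X1 = Y1" "\<pi> ` X2 = Y2" "\<pi> ` X3 = Y3"
    using 1 2 3 by (auto simp only: img bij_betw_def Un_upper1 Un_upper2 le_supI1)
  thus ?thesis using \<pi>(1) by blast
qed

section \<open>Subsets and disjoint triples of sample indices, with their counts\<close>

definition subsets :: "nat \<Rightarrow> 'a set \<Rightarrow> 'a set set" where
  "subsets r A = {S. S \<subseteq> A \<and> card S = r}"

lemma finite_subsets [simp]: "finite A \<Longrightarrow> finite (subsets r A)"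
  by (simp add: subsets_def)

lemma card_subsets: "finite A \<Longrightarrow> card (subsets r A) = card A choose r"
  by (simp add: subsets_def n_subsets)

text \<open>A strictly increasing tuple is the sorted enumeration of its range, so it can be
  recovered from that range. This moves the sums of the statistics from tuples to sets.\<close>

lemma bij_betw_incr_tuples:
  fixes A :: "nat set"
  assumes A: "finite A"
  shows "bij_betw (\<lambda>l. l ` {1..m}) (incr_tuples m A) (subsets m A)"
  unfolding bij_betw_def
proof
  have sorted: "sorted_list_of_set (l ` {1..m}) = map l [1..<Suc m]" if "l \<in> incr_tuples m A" for l
  proof -
    have mono: "strict_mono_on {1..m} l" using that by (simp add: incr_tuples_def)
    have "sorted_wrt (<) (map l [1..<Suc m])"
      using mono by (auto simp: sorted_wrt_map sorted_wrt_iff_nth_less strict_mono_on_def simp del: upt_Suc)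
    moreover have "set (map l [1..<Suc m]) = l ` {1..m}" by (auto simp del: upt_Suc)
    ultimately show ?thesis
      by (intro strict_sorted_equal) (auto simp del: upt_Suc)
  qed
  show "inj_on (\<lambda>l. l ` {1..m}) (incr_tuples m A)"
  proof (rule inj_onI)
    fix l l' assume l: "l \<in> incr_tuples m A" "l' \<in> incr_tuples m A" "l ` {1..m} = l' ` {1..m}"
    hence "map l [1..<Suc m] = map l' [1..<Suc m]" using sorted by metis
    hence "l k = l' k" if "k \<in> {1..m}" for k using that by (auto simp del: upt_Suc)
    moreover have "l \<in> extensional {1..m}" "l' \<in> extensional {1..m}"
      using l by (auto simp: incr_tuples_def PiE_def)
    ultimately show "l = l'" by (blast intro: extensionalityI)
  qed
  show "(\<lambda>l. l ` {1..m}) ` incr_tuples m A = subsets m A"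
  proof (intro set_eqI iffI)
    fix S assume "S \<in> (\<lambda>l. l ` {1..m}) ` incr_tuples m A"
    then obtain l where l: "l \<in> {1..m} \<rightarrow>\<^sub>E A" "strict_mono_on {1..m} l" "S = l ` {1..m}"
      by (auto simp: incr_tuples_def)
    hence "card S = m" by (simp add: card_image strict_mono_on_imp_inj_on)
    thus "S \<in> subsets m A" using l by (auto simp: subsets_def)
  next
    fix S assume S: "S \<in> subsets m A"
    hence fin: "finite S" "card S = m" "S \<subseteq> A" using A by (auto simp: subsets_def intro: finite_subset)
    let ?xs = "sorted_list_of_set S"
    \<comment> \<open>Tuples are indexed from 1 and lists from 0, hence \<open>k - 1\<close>; the
      restriction makes \<open>l\<close> extensional.\<close>
    define l where "l = (\<lambda>k\<in>{1..m}. ?xs ! (k - 1))"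
    have len: "length ?xs = m" using fin by simp
    have "l ` {1..m} = set ?xs"
    proof -
      have "l ` {1..m} = (\<lambda>k. ?xs ! (k - 1)) ` {1..m}" by (auto simp: l_def)
      also have "\<dots> = (\<lambda>k. ?xs ! (k - 1)) ` Suc ` {..<m}"
        by (simp only: image_Suc_lessThan)
      also have "\<dots> = set ?xs" unfolding set_conv_nth image_image using len by auto
      finally show ?thesis .
    qed
    hence img: "l ` {1..m} = S" using fin by simp
    have "strict_mono_on {1..m} l"
    proof (rule strict_mono_onI)
      fix r s assume "r \<in> {1..m}" "s \<in> {1..m}" "r < s"
      thus "l r < l s" using strict_sorted_list_of_set[of S] len
        by (auto simp: l_def sorted_wrt_iff_nth_less)
    qed
    moreover have "l \<in> {1..m} \<rightarrow>\<^sub>E A" using img fin(3) by (auto simp: l_def)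
    ultimately show "S \<in> (\<lambda>l. l ` {1..m}) ` incr_tuples m A"
      using img by (auto simp: incr_tuples_def)
  qed
qed

lemma incr_tuples_inj: "l \<in> incr_tuples m A \<Longrightarrow> inj_on l {1..m}"
  by (simp add: incr_tuples_def strict_mono_on_imp_inj_on)

text \<open>Here \<open>a\<close> is the point shared by two kernel evaluations, and
  \<open>R\<close>, \<open>R'\<close> are their other arguments; \<open>insert a R\<close> and
  \<open>insert a R'\<close> then meet in \<open>a\<close> alone.\<close>

definition disjoint_triples :: "nat \<Rightarrow> 'a set \<Rightarrow> ('a \<times> 'a set \<times> 'a set) set" where
  "disjoint_triples r A =
     (SIGMA a:A. SIGMA R:subsets r (A - {a}). subsets r (A - {a} - R))"

lemma disjoint_triples_iff:
  "(a, R, R') \<in> disjoint_triples r A \<longleftrightarrow> a \<in> A \<and> R \<subseteq> A - {a} \<and> card R = r \<and>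
    R' \<subseteq> A - {a} - R \<and> card R' = r"
  by (auto simp: disjoint_triples_def subsets_def)

lemma finite_disjoint_triples [simp]: "finite A \<Longrightarrow> finite (disjoint_triples r A)"
  by (auto simp: disjoint_triples_def)

lemma sum_disjoint_triples:
  assumes "finite A"
  shows "(\<Sum>t\<in>disjoint_triples r A. F t) =
    (\<Sum>a\<in>A. \<Sum>R\<in>subsets r (A - {a}). \<Sum>R'\<in>subsets r (A - {a} - R). F (a, R, R'))"
  unfolding disjoint_triples_def using assms by (simp add: sum.Sigma)

lemma card_disjoint_triples:
  assumes A: "finite A"
  shows "card (disjoint_triples r A) =
    card A * ((card A - 1) choose r) * ((card A - 1 - r) choose r)"
proof -
  have "card (A - {a} - R) = card A - 1 - r" if "a \<in> A" "R \<in> subsets r (A - {a})" for a R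
  proof -
    have "finite R" using that A by (auto simp: subsets_def intro: finite_subset)
    thus ?thesis using that A by (simp add: subsets_def card_Diff_subset)
  qed
  hence "card (disjoint_triples r A) =
     (\<Sum>a\<in>A. \<Sum>R\<in>subsets r (A - {a}). (card A - 1 - r) choose r)"
    using A by (simp add: disjoint_triples_def card_subsets)
  also have "\<dots> = card A * ((card A - 1) choose r) * ((card A - 1 - r) choose r)"
    using A by (simp add: card_subsets)
  finally show ?thesis .
qed

lemma average_over_permutations_subsets:
  fixes G :: "'a set \<Rightarrow> real"
  assumes A: "finite A" and S: "S \<in> subsets r A"
  shows "(\<Sum>\<pi> | \<pi> permutes A. G (\<pi> ` S)) / real (card {\<pi>. \<pi> permutes A}) =
    (\<Sum>S\<in>subsets r A. G S) / real (card A choose r)"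
proof -
  have inj: "inj \<pi>" if "\<pi> permutes A" for \<pi> using that by (rule permutes_inj)
  have "(\<Sum>\<pi> | \<pi> permutes A. G (\<pi> ` S)) / real (card {\<pi>. \<pi> permutes A}) =
    (\<Sum>S\<in>subsets r A. G S) / real (card (subsets r A))"
  proof (rule average_over_permutations[where act = "\<lambda>\<pi> S. \<pi> ` S", OF A _ _ _ _ _ S])
    show "finite (subsets r A)" using A by simp
    fix \<pi> :: "'a \<Rightarrow> 'a" assume \<pi>: "\<pi> permutes A"
    show "inj_on ((`) \<pi>) (subsets r A)"
      using inj[OF \<pi>] by (auto intro!: inj_onI simp: inj_image_eq_iff)
    show "\<pi> ` T \<in> subsets r A" if "T \<in> subsets r A" for T
      using that permutes_image[OF \<pi>] inj_on_subset[OF inj[OF \<pi>]]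
      by (auto simp: subsets_def card_image)
  next
    fix S T assume "S \<in> subsets r A" "T \<in> subsets r A"
    thus "\<exists>\<sigma>. \<sigma> permutes A \<and> \<sigma> ` S = T"
      using permutes_maps_disjoint[OF A, of S "{}" "{}" T "{}" "{}"] by (auto simp: subsets_def)
  qed (simp add: image_comp)
  thus ?thesis using A by (simp add: card_subsets)
qed

lemma average_over_permutations_triples:
  fixes G :: "'a \<times> 'a set \<times> 'a set \<Rightarrow> real"
  assumes A: "finite A" and t: "(a, R, R') \<in> disjoint_triples r A"
  shows "(\<Sum>\<pi> | \<pi> permutes A. G (\<pi> a, \<pi> ` R, \<pi> ` R')) / real (card {\<pi>. \<pi> permutes A}) =
    (\<Sum>t\<in>disjoint_triples r A. G t) / real (card (disjoint_triples r A))"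
proof -
  have inj: "inj \<pi>" if "\<pi> permutes A" for \<pi> using that by (rule permutes_inj)
  let ?act = "\<lambda>\<pi> (a, R, R'). (\<pi> a, \<pi> ` R, \<pi> ` R')"
  have "(\<Sum>\<pi> | \<pi> permutes A. G (?act \<pi> (a, R, R'))) / real (card {\<pi>. \<pi> permutes A}) =
    (\<Sum>t\<in>disjoint_triples r A. G t) / real (card (disjoint_triples r A))"
  proof (rule average_over_permutations[where act = ?act, OF A _ _ _ _ _ t])
    show "finite (disjoint_triples r A)" using A by simp
    fix \<pi> :: "'a \<Rightarrow> 'a" assume \<pi>: "\<pi> permutes A"
    show "inj_on (?act \<pi>) (disjoint_triples r A)"
      using inj[OF \<pi>] by (auto intro!: inj_onI simp: inj_image_eq_iff inj_eq)
    show "?act \<pi> t \<in> disjoint_triples r A" if "t \<in> disjoint_triples r A" for t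
    proof -
      obtain b S S' where t: "t = (b, S, S')" by (cases t)
      have "\<pi> ` (A - {b}) = A - {\<pi> b}" "\<pi> ` (A - {b} - S) = A - {\<pi> b} - \<pi> ` S"
        using permutes_image[OF \<pi>] by (simp_all add: image_set_diff[OF inj[OF \<pi>]])
      moreover have "\<pi> b \<in> A" "\<pi> ` S \<subseteq> \<pi> ` (A - {b})" "\<pi> ` S' \<subseteq> \<pi> ` (A - {b} - S)"
        "card (\<pi> ` S) = r" "card (\<pi> ` S') = r"
        using that permutes_in_image[OF \<pi>] inj_on_subset[OF inj[OF \<pi>]] unfolding t
        by (auto simp: disjoint_triples_iff card_image intro!: image_mono)
      ultimately show ?thesis by (simp add: t disjoint_triples_iff)
    qed
  next
    fix s t assume st: "s \<in> disjoint_triples r A" "t \<in> disjoint_triples r A"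
    obtain b S S' c T T' where s: "s = (b, S, S')" and t: "t = (c, T, T')" by (cases s, cases t)
    have "\<exists>\<pi>. \<pi> permutes A \<and> \<pi> ` {b} = {c} \<and> \<pi> ` S = T \<and> \<pi> ` S' = T'"
      using st unfolding s t disjoint_triples_iff by (intro permutes_maps_disjoint[OF A]) auto
    thus "\<exists>\<sigma>. \<sigma> permutes A \<and> ?act \<sigma> s = t" by (auto simp: s t)
  qed (auto simp: image_comp)
  thus ?thesis by simp
qed

text \<open>Each m-set \<open>S\<close> arises as \<open>insert a R\<close> once for every
  \<open>a\<close> in \<open>S\<close>, that is, m times.\<close>

lemma sum_insert_subsets:
  fixes F :: "'a set \<Rightarrow> real"
  assumes A: "finite A" and m: "m \<ge> 1"
  shows "(\<Sum>a\<in>A. \<Sum>R\<in>subsets (m - 1) (A - {a}). F (insert a R)) = real m * (\<Sum>S\<in>subsets m A. F S)"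
proof -
  have "(\<Sum>a\<in>A. \<Sum>R\<in>subsets (m - 1) (A - {a}). F (insert a R)) =
     (\<Sum>(a, R)\<in>(SIGMA a:A. subsets (m - 1) (A - {a})). F (insert a R))"
    using A by (simp add: sum.Sigma)
  also have "\<dots> = (\<Sum>(S, a)\<in>(SIGMA S:subsets m A. S). F S)"
  proof (rule sum.reindex_bij_witness[of _ "\<lambda>(S, a). (a, S - {a})" "\<lambda>(a, R). (insert a R, a)"])
    fix p assume "p \<in> (SIGMA a:A. subsets (m - 1) (A - {a}))"
    moreover have "card (insert a R) = m" if "R \<subseteq> A - {a}" "card R = m - 1" for a R
    proof -
      have "finite R" "a \<notin> R" using that A by (auto intro: finite_subset)
      thus ?thesis using that m by simp
    qed
    ultimately show "(case p of (a, R) \<Rightarrow> (insert a R, a)) \<in> (SIGMA S:subsets m A. S)"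
      by (auto simp: subsets_def)
  qed (auto simp: subsets_def)
  also have "\<dots> = (\<Sum>S\<in>subsets m A. \<Sum>a\<in>S. F S)"
    using A by (subst sum.Sigma) (auto simp: subsets_def intro: finite_subset)
  also have "\<dots> = (\<Sum>S\<in>subsets m A. real m * F S)"
    by (intro sum.cong) (auto simp: subsets_def)
  finally show ?thesis by (simp add: sum_distrib_left)
qed

lemma card_subsets_disjoint:
  assumes "finite A" "S \<in> subsets m A"
  shows "card {T \<in> subsets r A. S \<inter> T = {}} = (card A - m) choose r"
proof -
  have "{T \<in> subsets r A. S \<inter> T = {}} = subsets r (A - S)"
    by (auto simp: subsets_def)
  moreover have "card (A - S) = card A - m"
    using assms by (auto simp: subsets_def card_Diff_subset finite_subset)
  ultimately show ?thesis using assms(1) by (simp add: card_subsets)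
qed

text \<open>There are m choices for the common point \<open>s\<close>; the other
  \<open>m - 1\<close> points of \<open>T\<close> come from outside \<open>S\<close>. The inverse
  map reads \<open>s\<close> off as the only element of \<open>S \<inter> T\<close>.\<close>

lemma card_subsets_meet_once:
  assumes A: "finite A" and S: "S \<in> subsets m A" and m: "m \<ge> 1"
  shows "card {T \<in> subsets m A. card (S \<inter> T) = 1} = m * ((card A - m) choose (m - 1))"
proof -
  have finS: "finite S" "card S = m" "S \<subseteq> A" using A S by (auto simp: subsets_def intro: finite_subset)
  have "bij_betw (\<lambda>(s, R). insert s R) (S \<times> subsets (m - 1) (A - S)) {T \<in> subsets m A. card (S \<inter> T) = 1}"
  proof (rule bij_betw_byWitness[where f' = "\<lambda>T. (the_elem (S \<inter> T), T - S)"])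
    have *: "S \<inter> insert s R = {s}" if "s \<in> S" "R \<subseteq> A - S" for s R using that by auto
    have "the_elem (S \<inter> insert s R) = s \<and> insert s R - S = R" if "s \<in> S" "R \<subseteq> A - S" for s R
      using that by (auto simp only: *[OF that] the_elem_eq)
    thus "\<forall>p\<in>S \<times> subsets (m - 1) (A - S).
       (\<lambda>T. (the_elem (S \<inter> T), T - S)) (case p of (s, R) \<Rightarrow> insert s R) = p"
      by (auto simp only: subsets_def split: prod.splits)
    show "(\<lambda>(s, R). insert s R) ` (S \<times> subsets (m - 1) (A - S)) \<subseteq> {T \<in> subsets m A. card (S \<inter> T) = 1}"
    proof safe
      fix s R assume sR: "s \<in> S" "R \<in> subsets (m - 1) (A - S)"
      hence R: "finite R" "s \<notin> R" "R \<subseteq> A - S" "card R = m - 1"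
        using A by (auto simp: subsets_def intro: finite_subset)
      show "insert s R \<in> subsets m A" using sR R finS m by (auto simp: subsets_def)
      show "card (S \<inter> insert s R) = 1" using *[OF sR(1) R(3)] by simp
    qed
    show "\<forall>T\<in>{T \<in> subsets m A. card (S \<inter> T) = 1}.
       (case (the_elem (S \<inter> T), T - S) of (s, R) \<Rightarrow> insert s R) = T"
    proof
      fix T assume "T \<in> {T \<in> subsets m A. card (S \<inter> T) = 1}"
      hence "card (S \<inter> T) = 1" by blast
      then obtain s where s: "S \<inter> T = {s}" by (rule card_1_singletonE)
      have "insert s (T - S) = T" using s by blast
      thus "(case (the_elem (S \<inter> T), T - S) of (s, R) \<Rightarrow> insert s R) = T"
        by (simp add: s)
    qed
    show "(\<lambda>T. (the_elem (S \<inter> T), T - S)) ` {T \<in> subsets m A. card (S \<inter> T) = 1}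
       \<subseteq> S \<times> subsets (m - 1) (A - S)"
    proof safe
      fix T assume T: "T \<in> subsets m A" "card (S \<inter> T) = 1"
      from T(2) obtain s where s: "S \<inter> T = {s}" by (rule card_1_singletonE)
      show "the_elem (S \<inter> T) \<in> S" unfolding s using s by auto
      have "card (T - S) = card T - card (S \<inter> T)"
        using finS by (simp add: card_Diff_subset_Int Int_commute)
      thus "T - S \<in> subsets (m - 1) (A - S)" using T by (auto simp: subsets_def)
    qed
  qed
  from bij_betw_same_card[OF this, symmetric] show ?thesis
    using finS A by (simp add: card_subsets card_cartesian_product card_Diff_subset)
qed

section \<open>Hoeffding bound for averages of block means\<close>

text \<open>Independence is required only among the \<open>K\<close> terms of one \<open>p\<close>.
  Terms with different \<open>p\<close> may depend on each other arbitrarily, since the exponential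
  of the average is bounded by the average of the exponentials before expectations are
  taken.\<close>

lemma (in prob_space) Hoeffding_average_ge:
  fixes Z :: "'p \<Rightarrow> nat \<Rightarrow> 'a \<Rightarrow> real"
  assumes I: "finite I" "I \<noteq> {}" and K: "K > 0" and c: "c > 0" and t: "t \<ge> 0"
    and indep: "\<And>p. p \<in> I \<Longrightarrow> indep_vars (\<lambda>_. borel) (Z p) {..<K}"
    and bound: "\<And>p b \<omega>. p \<in> I \<Longrightarrow> b < K \<Longrightarrow> \<omega> \<in> space M \<Longrightarrow> \<bar>Z p b \<omega>\<bar> \<le> c"
    and mean: "\<And>p b. p \<in> I \<Longrightarrow> b < K \<Longrightarrow> expectation (Z p b) = \<mu>"
  shows "prob {\<omega>\<in>space M. (\<Sum>p\<in>I. (\<Sum>b<K. Z p b \<omega>) / real K) / real (card I) - \<mu> \<ge> t}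
    \<le> exp (- (real K * t\<^sup>2 / (2 * c\<^sup>2)))"
\<comment> \<open>The Chernoff bound needs a positive rate \<open>l\<close>; for
  \<open>t = 0\<close> the right-hand side is 1.\<close>
proof (cases "t = 0")
  case True
  thus ?thesis by simp
next
  case False
  hence t: "t > 0" using t by simp
  \<comment> \<open>This \<open>l\<close> minimises the final exponent
    \<open>- l * K * t + K * l\<^sup>2 * c\<^sup>2 / 2\<close>; the second term comes from
    Hoeffding's lemma on an interval of length \<open>2 * c\<close>.\<close>
  define l where "l = t / c\<^sup>2"
  have l: "l > 0" using t c by (simp add: l_def)
  define N where "N = real (card I)"
  have N: "N > 0" using I by (simp add: N_def card_gt_0_iff)
  have [measurable]: "Z p b \<in> borel_measurable M" if "p \<in> I" "b < K" for p b
    using indep[OF that(1)] that(2) unfolding indep_vars_def by auto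
  define V where "V p \<omega> = (\<Sum>b<K. Z p b \<omega> - \<mu>)" for p \<omega>
  have V_meas [measurable]: "V p \<in> borel_measurable M" if "p \<in> I" for p
    unfolding V_def[abs_def] using that by measurable
  have V: "(\<Sum>p\<in>I. (\<Sum>b<K. Z p b \<omega>) / real K) / real (card I) - \<mu> = (\<Sum>p\<in>I. V p \<omega>) / (N * K)" for \<omega>
    using K N by (simp add: V_def sum_subtractf N_def field_simps flip: sum_divide_distrib)
  have mgf: "(\<integral>\<^sup>+\<omega>. exp (l * V p \<omega>) \<partial>M) \<le> ennreal (exp (real K * (l\<^sup>2 * (2 * c)\<^sup>2 / 8)))" if p: "p \<in> I" for p
  proof -
    have "(\<integral>\<^sup>+\<omega>. exp (l * V p \<omega>) \<partial>M) = (\<integral>\<^sup>+\<omega>. (\<Prod>b<K. ennreal (exp (l * (Z p b \<omega> - \<mu>)))) \<partial>M)"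
      by (intro nn_integral_cong) (simp add: V_def sum_distrib_left exp_sum prod_ennreal)
    also have "\<dots> = (\<Prod>b<K. \<integral>\<^sup>+\<omega>. ennreal (exp (l * (Z p b \<omega> - \<mu>))) \<partial>M)"
      by (intro indep_vars_nn_integral indep_vars_compose2[OF indep[OF p]]) auto
    also have "\<dots> \<le> (\<Prod>b<K. ennreal (exp (l\<^sup>2 * (2 * c)\<^sup>2 / 8)))"
    proof (intro prod_mono_ennreal)
      fix b assume "b \<in> {..<K}"
      hence b: "b < K" by simp
      interpret interval_bounded_random_variable M "Z p b" "-c" c
        by unfold_locales (use p b bound[OF p b] in \<open>auto intro!: AE_I2 simp: abs_le_iff minus_le_iff\<close>)
      show "(\<integral>\<^sup>+\<omega>. ennreal (exp (l * (Z p b \<omega> - \<mu>))) \<partial>M) \<le> ennreal (exp (l\<^sup>2 * (2 * c)\<^sup>2 / 8))"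
        using Hoeffdings_lemma_nn_integral[OF l] by (simp add: mean[OF p b])
    qed
    also have "\<dots> = ennreal (exp (real K * (l\<^sup>2 * (2 * c)\<^sup>2 / 8)))"
      by (simp add: ennreal_power flip: exp_of_nat_mult)
    finally show ?thesis .
  qed
  have jensen: "exp (l * ((\<Sum>p\<in>I. V p \<omega>) / N)) \<le> (\<Sum>p\<in>I. exp (l * V p \<omega>) / N)" for \<omega>
  proof -
    have "exp (l * (\<Sum>p\<in>I. (1 / N) *\<^sub>R V p \<omega>)) \<le> (\<Sum>p\<in>I. (1 / N) * exp (l * V p \<omega>))"
      by (rule convex_on_sum[OF I convex_on_exp]) (use N l in \<open>auto simp: N_def\<close>)
    thus ?thesis by (simp add: sum_divide_distrib)
  qed
  have "ennreal (prob {\<omega>\<in>space M. (\<Sum>p\<in>I. V p \<omega>) / N \<ge> K * t}) =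
      emeasure M {\<omega>\<in>space M. (\<Sum>p\<in>I. V p \<omega>) / N \<ge> K * t}"
    by (simp add: emeasure_eq_measure)
  also have "\<dots> \<le> ennreal (exp (- l * (K * t))) * (\<integral>\<^sup>+\<omega>\<in>space M. exp (l * ((\<Sum>p\<in>I. V p \<omega>) / N)) \<partial>M)"
    by (intro Chernoff_ineq_nn_integral_ge l) auto
  also have "(\<integral>\<^sup>+\<omega>\<in>space M. exp (l * ((\<Sum>p\<in>I. V p \<omega>) / N)) \<partial>M)
      \<le> (\<integral>\<^sup>+\<omega>. (\<Sum>p\<in>I. ennreal (1 / N) * ennreal (exp (l * V p \<omega>))) \<partial>M)"
  proof (intro nn_integral_mono)
    fix \<omega>
    have "ennreal (exp (l * ((\<Sum>p\<in>I. V p \<omega>) / N))) \<le> ennreal (\<Sum>p\<in>I. 1 / N * exp (l * V p \<omega>))"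
      using jensen by (intro ennreal_leI) simp
    also have "\<dots> = (\<Sum>p\<in>I. ennreal (1 / N * exp (l * V p \<omega>)))"
      using N by (intro sum_ennreal[symmetric]) auto
    also have "\<dots> = (\<Sum>p\<in>I. ennreal (1 / N) * ennreal (exp (l * V p \<omega>)))"
      using N by (simp only: ennreal_mult' zero_le_divide_1_iff less_imp_le)
    finally show "ennreal (exp (l * ((\<Sum>p\<in>I. V p \<omega>) / N))) * indicator (space M) \<omega>
       \<le> (\<Sum>p\<in>I. ennreal (1 / N) * ennreal (exp (l * V p \<omega>)))"
      by (auto simp: indicator_def)
  qed
  also have "\<dots> = (\<Sum>p\<in>I. ennreal (1 / N) * (\<integral>\<^sup>+\<omega>. ennreal (exp (l * V p \<omega>)) \<partial>M))"
    by (subst nn_integral_sum) (auto intro!: sum.cong nn_integral_cmult)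
  also have "\<dots> \<le> (\<Sum>p\<in>I. ennreal (1 / N) * ennreal (exp (real K * (l\<^sup>2 * (2 * c)\<^sup>2 / 8))))"
    by (intro sum_mono mult_left_mono mgf) auto
  also have "\<dots> = (\<Sum>p\<in>I. ennreal (1 / N * exp (real K * (l\<^sup>2 * (2 * c)\<^sup>2 / 8))))"
    using N by (simp only: ennreal_mult' zero_le_divide_1_iff less_imp_le)
  also have "\<dots> = ennreal (\<Sum>p\<in>I. 1 / N * exp (real K * (l\<^sup>2 * (2 * c)\<^sup>2 / 8)))"
    using N by (intro sum_ennreal) auto
  also have "(\<Sum>p\<in>I. 1 / N * exp (real K * (l\<^sup>2 * (2 * c)\<^sup>2 / 8))) = exp (real K * (l\<^sup>2 * (2 * c)\<^sup>2 / 8))"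
    using N by (simp add: N_def)
  finally have "ennreal (prob {\<omega>\<in>space M. (\<Sum>p\<in>I. V p \<omega>) / N \<ge> K * t}) \<le>
      ennreal (exp (- l * (K * t)) * exp (real K * (l\<^sup>2 * (2 * c)\<^sup>2 / 8)))"
    by (simp add: ennreal_mult' mult_left_mono)
  hence "prob {\<omega>\<in>space M. (\<Sum>p\<in>I. V p \<omega>) / N \<ge> K * t} \<le>
      exp (- l * (K * t)) * exp (real K * (l\<^sup>2 * (2 * c)\<^sup>2 / 8))"
    by (subst (asm) ennreal_le_iff) auto
  also have "\<dots> = exp (- (real K * t\<^sup>2 / (2 * c\<^sup>2)))"
    using c by (simp add: l_def flip: exp_add) (simp add: field_simps power2_eq_square)
  also have "{\<omega>\<in>space M. (\<Sum>p\<in>I. V p \<omega>) / N \<ge> K * t} =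
     {\<omega>\<in>space M. (\<Sum>p\<in>I. (\<Sum>b<K. Z p b \<omega>) / real K) / real (card I) - \<mu> \<ge> t}"
    unfolding V using K N by (simp add: field_simps)
  finally show ?thesis .
qed

text \<open>The lower tail is the upper tail of the negated variables, whose mean is
  \<open>- \<mu>\<close>; adding both tails gives the factor 2.\<close>

lemma (in prob_space) Hoeffding_average:
  fixes Z :: "'p \<Rightarrow> nat \<Rightarrow> 'a \<Rightarrow> real"
  assumes I: "finite I" "I \<noteq> {}" and K: "K > 0" and c: "c > 0" and t: "t \<ge> 0"
    and indep: "\<And>p. p \<in> I \<Longrightarrow> indep_vars (\<lambda>_. borel) (Z p) {..<K}"
    and bound: "\<And>p b \<omega>. p \<in> I \<Longrightarrow> b < K \<Longrightarrow> \<omega> \<in> space M \<Longrightarrow> \<bar>Z p b \<omega>\<bar> \<le> c"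
    and mean: "\<And>p b. p \<in> I \<Longrightarrow> b < K \<Longrightarrow> expectation (Z p b) = \<mu>"
  shows "prob {\<omega>\<in>space M. \<bar>(\<Sum>p\<in>I. (\<Sum>b<K. Z p b \<omega>) / real K) / real (card I) - \<mu>\<bar> \<ge> t}
    \<le> 2 * exp (- (real K * t\<^sup>2 / (2 * c\<^sup>2)))"
proof -
  have [measurable]: "Z p b \<in> borel_measurable M" if "p \<in> I" "b < K" for p b
    using indep[OF that(1)] that(2) unfolding indep_vars_def by auto
  let ?A = "\<lambda>Z \<omega>. (\<Sum>p\<in>I. (\<Sum>b<K. Z p b \<omega>) / real K) / real (card I)"
  define U where "U = ?A Z"
  have U_meas [measurable]: "U \<in> borel_measurable M"
    unfolding U_def by (auto intro!: borel_measurable_sum borel_measurable_divide)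
  have ge: "prob {\<omega>\<in>space M. U \<omega> - \<mu> \<ge> t} \<le> exp (- (real K * t\<^sup>2 / (2 * c\<^sup>2)))"
    unfolding U_def by (rule Hoeffding_average_ge[OF I K c t indep bound mean])
  have "prob {\<omega>\<in>space M. ?A (\<lambda>p b \<omega>. - Z p b \<omega>) \<omega> - (- \<mu>) \<ge> t} \<le> exp (- (real K * t\<^sup>2 / (2 * c\<^sup>2)))"
  proof (rule Hoeffding_average_ge[OF I K c t])
    show "indep_vars (\<lambda>_. borel) (\<lambda>b \<omega>. - Z p b \<omega>) {..<K}" if "p \<in> I" for p
      by (rule indep_vars_compose2[OF indep[OF that]]) simp
  qed (simp_all add: bound mean)
  hence le: "prob {\<omega>\<in>space M. - U \<omega> + \<mu> \<ge> t} \<le> exp (- (real K * t\<^sup>2 / (2 * c\<^sup>2)))"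
    unfolding U_def by (simp add: sum_negf)
  have "{\<omega>\<in>space M. \<bar>U \<omega> - \<mu>\<bar> \<ge> t} =
      {\<omega>\<in>space M. U \<omega> - \<mu> \<ge> t} \<union> {\<omega>\<in>space M. - U \<omega> + \<mu> \<ge> t}"
    by auto
  also have "prob \<dots> \<le> prob {\<omega>\<in>space M. U \<omega> - \<mu> \<ge> t} + prob {\<omega>\<in>space M. - U \<omega> + \<mu> \<ge> t}"
    by (rule measure_Un_le) measurable
  also have "\<dots> \<le> 2 * exp (- (real K * t\<^sup>2 / (2 * c\<^sup>2)))"
    using ge le by simp
  finally show ?thesis unfolding U_def .
qed

section \<open>Conditional expectation given an independent coordinate\<close>

text \<open>
  The constant \<open>indep_var\<close> forces both variables to have the same type, so independence is expressed
  here by the joint law.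
\<close>

lemma (in prob_space) real_cond_exp_indep_var:
  fixes \<phi> :: "'b \<times> 'c \<Rightarrow> real"
  assumes X [measurable]: "X \<in> measurable M N" and Y [measurable]: "Y \<in> measurable M L"
    and joint: "distr M (N \<Otimes>\<^sub>M L) (\<lambda>\<omega>. (X \<omega>, Y \<omega>)) = distr M N X \<Otimes>\<^sub>M distr M L Y"
    and \<phi> [measurable]: "\<phi> \<in> borel_measurable (N \<Otimes>\<^sub>M L)"
    and bound: "\<And>z. z \<in> space (N \<Otimes>\<^sub>M L) \<Longrightarrow> \<bar>\<phi> z\<bar> \<le> B"
  shows "AE \<omega> in M. real_cond_exp M (vimage_algebra (space M) X N) (\<lambda>\<omega>. \<phi> (X \<omega>, Y \<omega>)) \<omega> =
      (\<integral>y. \<phi> (X \<omega>, y) \<partial>distr M L Y)"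
proof -
  interpret PX: prob_space "distr M N X" by (rule prob_space_distr) simp
  interpret PY: prob_space "distr M L Y" by (rule prob_space_distr) simp
  interpret PP: pair_prob_space "distr M N X" "distr M L Y" ..
  let ?F = "vimage_algebra (space M) X N"
  have sub: "subalgebra M ?F"
    unfolding subalgebra_def using X measurable_space[OF X]
    by (auto simp: sets_vimage_algebra2 Pi_iff)
  interpret F: sigma_finite_subalgebra M ?F
    by (rule finite_measure_subalgebra_is_sigma_finite) (use sub in \<open>auto intro!: finite_measure_subalgebra.intro finite_measure_subalgebra_axioms.intro finite_measure_axioms\<close>)
  define g where "g x = (\<integral>y. \<phi> (x, y) \<partial>distr M L Y)" for x
  have g [measurable]: "g \<in> borel_measurable N"
    unfolding g_def by measurable
  have g_bound: "\<bar>g x\<bar> \<le> B" if "x \<in> space N" for x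
  proof -
    have "\<bar>g x\<bar> \<le> (\<integral>y. \<bar>\<phi> (x, y)\<bar> \<partial>distr M L Y)"
      unfolding g_def by (rule integral_abs_bound)
    also have "\<dots> \<le> (\<integral>y. B \<partial>distr M L Y)"
      using that bound \<phi>
      by (intro integral_mono_AE PY.integrable_const integrable_abs PY.integrable_const_bound[where B = B] AE_I2)
         (auto simp: space_pair_measure)
    finally show ?thesis using PY.prob_space by simp
  qed
  have XF [measurable]: "X \<in> measurable ?F N"
    using measurable_space[OF X] by (intro measurable_vimage_algebra1) auto
  show ?thesis
    unfolding g_def[symmetric]
  proof (rule F.real_cond_exp_charact)
    \<comment> \<open>Events of the generated sigma-algebra are preimages under \<open>X\<close> of
      sets \<open>C\<close>. Checking the defining identity of conditional expectation on them is
      Fubini for the product law, with \<open>indicator C\<close> depending on the first coordinate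
      only.\<close>
    fix A assume "A \<in> sets ?F"
    then obtain C where C [measurable]: "C \<in> sets N" and A: "A = X -` C \<inter> space M"
      using measurable_space[OF X] by (auto simp: sets_vimage_algebra2 Pi_iff)
    have "(\<integral>\<omega>\<in>A. \<phi> (X \<omega>, Y \<omega>) \<partial>M) = (\<integral>\<omega>. indicator C (X \<omega>) * \<phi> (X \<omega>, Y \<omega>) \<partial>M)"
      unfolding set_lebesgue_integral_def A
      by (intro Bochner_Integration.integral_cong) (auto simp: indicator_def)
    also have "\<dots> = (\<integral>z. indicator C (fst z) * \<phi> z \<partial>distr M (N \<Otimes>\<^sub>M L) (\<lambda>\<omega>. (X \<omega>, Y \<omega>)))"
      by (subst integral_distr) auto
    also have "\<dots> = (\<integral>z. indicator C (fst z) * \<phi> z \<partial>(distr M N X \<Otimes>\<^sub>M distr M L Y))"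
      by (simp only: joint)
    also have "\<dots> = (\<integral>x. \<integral>y. indicator C x * \<phi> (x, y) \<partial>distr M L Y \<partial>distr M N X)"
      using bound
      by (subst PP.integral_fst'[symmetric])
         (auto intro!: PP.integrable_const_bound[where B = "\<bar>B\<bar>"] AE_I2
           simp: indicator_def space_pair_measure intro!: order_trans[OF bound abs_ge_self])
    also have "\<dots> = (\<integral>x. indicator C x * g x \<partial>distr M N X)"
      by (simp add: g_def)
    also have "\<dots> = (\<integral>\<omega>. indicator C (X \<omega>) * g (X \<omega>) \<partial>M)"
      by (subst integral_distr) auto
    also have "\<dots> = (\<integral>\<omega>\<in>A. g (X \<omega>) \<partial>M)"
      unfolding set_lebesgue_integral_def A
      by (intro Bochner_Integration.integral_cong) (auto simp: indicator_def)
    finally show "(\<integral>\<omega>\<in>A. \<phi> (X \<omega>, Y \<omega>) \<partial>M) = (\<integral>\<omega>\<in>A. g (X \<omega>) \<partial>M)" .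
  next
    show "integrable M (\<lambda>\<omega>. \<phi> (X \<omega>, Y \<omega>))"
      using bound measurable_space[OF X] measurable_space[OF Y]
      by (intro integrable_const_bound[where B = B] AE_I2) (auto simp: space_pair_measure)
    show "integrable M (\<lambda>\<omega>. g (X \<omega>))"
      using g_bound measurable_space[OF X]
      by (intro integrable_const_bound[where B = B] AE_I2) auto
  qed measurable
qed

text \<open>Given \<open>X\<close>, the two factors are independent with a common conditional mean,
  so the inner integral over the pair factors into a square. This turns the second moment of a
  conditional expectation into a moment of kernel values.\<close>

lemma (in prob_space) expectation_mult_cond_indep:
  fixes \<phi> :: "'b \<times> 'c \<Rightarrow> real"
  assumes X [measurable]: "X \<in> measurable M N"
    and Y [measurable]: "Y \<in> measurable M L" "Y' \<in> measurable M L"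
    and joint: "distr M (N \<Otimes>\<^sub>M (L \<Otimes>\<^sub>M L)) (\<lambda>\<omega>. (X \<omega>, Y \<omega>, Y' \<omega>)) =
      distr M N X \<Otimes>\<^sub>M (distr M L Y \<Otimes>\<^sub>M distr M L Y)"
    and \<phi> [measurable]: "\<phi> \<in> borel_measurable (N \<Otimes>\<^sub>M L)"
    and bound: "\<And>z. z \<in> space (N \<Otimes>\<^sub>M L) \<Longrightarrow> \<bar>\<phi> z\<bar> \<le> B"
  shows "expectation (\<lambda>\<omega>. \<phi> (X \<omega>, Y \<omega>) * \<phi> (X \<omega>, Y' \<omega>)) =
    expectation (\<lambda>\<omega>. (\<integral>y. \<phi> (X \<omega>, y) \<partial>distr M L Y)\<^sup>2)"
proof -
  let ?Q = "distr M L Y"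
  interpret PX: prob_space "distr M N X" by (rule prob_space_distr) simp
  interpret PY: prob_space ?Q by (rule prob_space_distr) simp
  interpret YY: pair_prob_space ?Q ?Q ..
  interpret PP: pair_prob_space "distr M N X" "?Q \<Otimes>\<^sub>M ?Q" ..
  have bnd: "\<bar>\<phi> (x, y) * \<phi> (x, y')\<bar> \<le> B * B" if "x \<in> space N" "y \<in> space L" "y' \<in> space L" for x y y'
    using bound[of "(x, y)"] bound[of "(x, y')"] that
    by (auto simp: abs_mult space_pair_measure intro!: mult_mono)
  have "expectation (\<lambda>\<omega>. \<phi> (X \<omega>, Y \<omega>) * \<phi> (X \<omega>, Y' \<omega>)) =
     (\<integral>z. \<phi> (fst z, fst (snd z)) * \<phi> (fst z, snd (snd z)) \<partial>distr M (N \<Otimes>\<^sub>M (L \<Otimes>\<^sub>M L)) (\<lambda>\<omega>. (X \<omega>, Y \<omega>, Y' \<omega>)))"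
    by (subst integral_distr) auto
  also have "\<dots> = (\<integral>z. \<phi> (fst z, fst (snd z)) * \<phi> (fst z, snd (snd z)) \<partial>(distr M N X \<Otimes>\<^sub>M (?Q \<Otimes>\<^sub>M ?Q)))"
    by (simp only: joint)
  also have "\<dots> = (\<integral>x. \<integral>w. \<phi> (x, fst w) * \<phi> (x, snd w) \<partial>(?Q \<Otimes>\<^sub>M ?Q) \<partial>distr M N X)"
    by (subst PP.integral_fst'[symmetric])
       (auto intro!: PP.integrable_const_bound[where B = "B * B"] AE_I2 bnd simp: space_pair_measure)
  also have "\<dots> = (\<integral>x. (\<integral>y. \<phi> (x, y) \<partial>?Q)\<^sup>2 \<partial>distr M N X)"
  proof (rule Bochner_Integration.integral_cong[OF refl])
    fix x assume "x \<in> space (distr M N X)"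
    hence x [measurable]: "x \<in> space N" by simp
    have "(\<integral>w. \<phi> (x, fst w) * \<phi> (x, snd w) \<partial>(?Q \<Otimes>\<^sub>M ?Q)) = (\<integral>y. \<integral>y'. \<phi> (x, y) * \<phi> (x, y') \<partial>?Q \<partial>?Q)"
      using x by (subst YY.integral_fst'[symmetric])
       (auto intro!: YY.integrable_const_bound[where B = "B * B"] AE_I2 bnd simp: space_pair_measure)
    also have "\<dots> = (\<integral>y. \<phi> (x, y) \<partial>?Q)\<^sup>2"
      by (simp add: power2_eq_square)
    finally show "(\<integral>w. \<phi> (x, fst w) * \<phi> (x, snd w) \<partial>(?Q \<Otimes>\<^sub>M ?Q)) = (\<integral>y. \<phi> (x, y) \<partial>?Q)\<^sup>2" .
  qed
  also have "\<dots> = expectation (\<lambda>\<omega>. (\<integral>y. \<phi> (X \<omega>, y) \<partial>?Q)\<^sup>2)"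
    by (subst integral_distr) auto
  finally show ?thesis .
qed

text \<open>The conditional expectation equals \<open>G\<close> almost everywhere, so the claim is
  the formula for the variance of \<open>G\<close>, with its second moment rewritten through the
  independent copy \<open>Y'\<close>. This removes conditional expectations from everything that
  follows.\<close>

lemma (in prob_space) variance_cond_exp:
  fixes \<phi> :: "'b \<times> 'c \<Rightarrow> real"
  assumes X [measurable]: "X \<in> measurable M N"
    and Y [measurable]: "Y \<in> measurable M L" "Y' \<in> measurable M L"
    and joint: "distr M (N \<Otimes>\<^sub>M (L \<Otimes>\<^sub>M L)) (\<lambda>\<omega>. (X \<omega>, Y \<omega>, Y' \<omega>)) =
      distr M N X \<Otimes>\<^sub>M (distr M L Y \<Otimes>\<^sub>M distr M L Y)"
    and \<phi> [measurable]: "\<phi> \<in> borel_measurable (N \<Otimes>\<^sub>M L)"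
    and bound: "\<And>z. z \<in> space (N \<Otimes>\<^sub>M L) \<Longrightarrow> \<bar>\<phi> z\<bar> \<le> B"
  shows "variance (real_cond_exp M (vimage_algebra (space M) X N) (\<lambda>\<omega>. \<phi> (X \<omega>, Y \<omega>))) =
    expectation (\<lambda>\<omega>. \<phi> (X \<omega>, Y \<omega>) * \<phi> (X \<omega>, Y' \<omega>)) - (expectation (\<lambda>\<omega>. \<phi> (X \<omega>, Y \<omega>)))\<^sup>2"
proof -
  let ?P = "distr M N X" and ?Q = "distr M L Y"
  interpret PX: prob_space ?P by (rule prob_space_distr) simp
  interpret PY: prob_space ?Q by (rule prob_space_distr) simp
  interpret YY: pair_prob_space ?Q ?Q ..
  \<comment> \<open>Needed to integrate \<open>Y'\<close> out of the joint law of the three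
    variables, leaving the product law of \<open>X\<close> and \<open>Y\<close>.\<close>
  have fst: "distr (?Q \<Otimes>\<^sub>M ?Q) L fst = ?Q"
  proof (rule measure_eqI)
    fix A assume "A \<in> sets (distr (?Q \<Otimes>\<^sub>M ?Q) L fst)"
    hence [measurable]: "A \<in> sets L" by simp
    have "fst -` A \<inter> space (?Q \<Otimes>\<^sub>M ?Q) = A \<times> space ?Q"
      using sets.sets_into_space[of A L] by (auto simp: space_pair_measure)
    thus "emeasure (distr (?Q \<Otimes>\<^sub>M ?Q) L fst) A = emeasure ?Q A"
      using PY.emeasure_space_1 by (subst emeasure_distr) (simp_all add: PY.emeasure_pair_measure_Times)
  qed simp
  have "distr M (N \<Otimes>\<^sub>M L) (\<lambda>\<omega>. (X \<omega>, Y \<omega>)) =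
     distr (distr M (N \<Otimes>\<^sub>M (L \<Otimes>\<^sub>M L)) (\<lambda>\<omega>. (X \<omega>, Y \<omega>, Y' \<omega>))) (N \<Otimes>\<^sub>M L) (\<lambda>(x, w). (id x, fst w))"
    by (subst distr_distr) (auto simp: comp_def)
  also have "\<dots> = distr ?P N id \<Otimes>\<^sub>M distr (?Q \<Otimes>\<^sub>M ?Q) L fst"
    unfolding joint by (subst pair_measure_distr) (auto simp: fst PY.sigma_finite_measure_axioms cong: distr_cong)
  also have "\<dots> = ?P \<Otimes>\<^sub>M ?Q"
    unfolding fst by (simp add: id_def distr_id2)
  finally have joint2: "distr M (N \<Otimes>\<^sub>M L) (\<lambda>\<omega>. (X \<omega>, Y \<omega>)) = ?P \<Otimes>\<^sub>M ?Q" .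
  let ?F = "vimage_algebra (space M) X N"
  have sub: "subalgebra M ?F"
    unfolding subalgebra_def using X measurable_space[OF X]
    by (auto simp: sets_vimage_algebra2 Pi_iff)
  interpret F: sigma_finite_subalgebra M ?F
    by (rule finite_measure_subalgebra_is_sigma_finite) (use sub in \<open>auto intro!: finite_measure_subalgebra.intro finite_measure_subalgebra_axioms.intro finite_measure_axioms\<close>)
  let ?c = "real_cond_exp M ?F (\<lambda>\<omega>. \<phi> (X \<omega>, Y \<omega>))"
  define G where "G \<omega> = (\<integral>y. \<phi> (X \<omega>, y) \<partial>distr M L Y)" for \<omega>
  have G [measurable]: "G \<in> borel_measurable M"
    unfolding G_def by measurable
  have ae: "AE \<omega> in M. ?c \<omega> = G \<omega>"
    unfolding G_def by (rule real_cond_exp_indep_var[OF X Y(1) joint2 \<phi> bound])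
  have int: "integrable M (\<lambda>\<omega>. \<phi> (X \<omega>, Y \<omega>))"
    using bound measurable_space[OF X] measurable_space[OF Y(1)]
    by (intro integrable_const_bound[where B = B] AE_I2) (auto simp: space_pair_measure)
  have "?c \<in> borel_measurable M" by measurable
  have E: "expectation ?c = expectation (\<lambda>\<omega>. \<phi> (X \<omega>, Y \<omega>))"
    using F.real_cond_exp_int(2)[OF int] .
  have EG: "expectation G = expectation (\<lambda>\<omega>. \<phi> (X \<omega>, Y \<omega>))"
    unfolding E[symmetric] by (rule integral_cong_AE) (use ae in auto)
  have G_bound: "\<bar>G \<omega>\<bar> \<le> B" if "\<omega> \<in> space M" for \<omega>
  proof -
    have x: "X \<omega> \<in> space N" using that measurable_space[OF X] by blast
    have "\<bar>G \<omega>\<bar> \<le> (\<integral>y. \<bar>\<phi> (X \<omega>, y)\<bar> \<partial>distr M L Y)"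
      unfolding G_def by (rule integral_abs_bound)
    also have "\<dots> \<le> (\<integral>y. B \<partial>distr M L Y)"
      using x bound \<phi>
      by (intro integral_mono_AE PY.integrable_const integrable_abs PY.integrable_const_bound[where B = B] AE_I2)
         (auto simp: space_pair_measure)
    finally show ?thesis using PY.prob_space by simp
  qed
  have intG: "integrable M G"
    using G_bound by (intro integrable_const_bound[where B = B] AE_I2) auto
  have intG2: "integrable M (\<lambda>\<omega>. (G \<omega>)\<^sup>2)"
    using G_bound
    by (intro integrable_const_bound[where B = "B\<^sup>2"] AE_I2)
       (auto simp: abs_le_square_iff[symmetric] intro: order_trans[OF _ abs_ge_self])
  have "variance ?c = variance G"
    unfolding E EG by (rule integral_cong_AE) (use ae in auto)
  also have "\<dots> = expectation (\<lambda>\<omega>. (G \<omega>)\<^sup>2) - (expectation G)\<^sup>2"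
    using intG intG2 by (rule variance_eq)
  also have "expectation (\<lambda>\<omega>. (G \<omega>)\<^sup>2) = expectation (\<lambda>\<omega>. \<phi> (X \<omega>, Y \<omega>) * \<phi> (X \<omega>, Y' \<omega>))"
    unfolding G_def by (rule expectation_mult_cond_indep[OF assms, symmetric])
  finally show ?thesis unfolding EG .
qed

text \<open>\<open>U\<close> and \<open>V\<close> have one type, their images under \<open>f\<close>
  and \<open>g\<close> may have different ones. So independence of two subfamilies of the sample
  yields a product law for a single vector and a pair of tuples.\<close>

lemma (in prob_space) indep_var_distr_pair:
  assumes ind: "indep_var S U T V"
    and f [measurable]: "f \<in> measurable S S'" and g [measurable]: "g \<in> measurable T T'"
  shows "distr M (S' \<Otimes>\<^sub>M T') (\<lambda>\<omega>. (f (U \<omega>), g (V \<omega>))) =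
    distr M S' (\<lambda>\<omega>. f (U \<omega>)) \<Otimes>\<^sub>M distr M T' (\<lambda>\<omega>. g (V \<omega>))"
proof -
  have U [measurable]: "U \<in> measurable M S" and V [measurable]: "V \<in> measurable M T"
    and joint: "distr M S U \<Otimes>\<^sub>M distr M T V = distr M (S \<Otimes>\<^sub>M T) (\<lambda>\<omega>. (U \<omega>, V \<omega>))"
    using ind by (auto simp: indep_var_distribution_eq)
  have gT: "g \<in> measurable (distr M T V) T'" and fS: "f \<in> measurable (distr M S U) S'" by simp_all
  interpret V: prob_space "distr M T V" by (rule prob_space_distr) simp
  interpret gV: prob_space "distr (distr M T V) T' g" by (rule V.prob_space_distr) simp
  have "distr M (S' \<Otimes>\<^sub>M T') (\<lambda>\<omega>. (f (U \<omega>), g (V \<omega>))) =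
    distr (distr M (S \<Otimes>\<^sub>M T) (\<lambda>\<omega>. (U \<omega>, V \<omega>))) (S' \<Otimes>\<^sub>M T') (\<lambda>(u, v). (f u, g v))"
    by (subst distr_distr) (auto simp: comp_def)
  also have "\<dots> = distr (distr M S U) S' f \<Otimes>\<^sub>M distr (distr M T V) T' g"
    unfolding joint[symmetric]
    by (rule pair_measure_distr[symmetric, OF fS gT gV.sigma_finite_measure_axioms])
  also have "\<dots> = distr M S' (\<lambda>\<omega>. f (U \<omega>)) \<Otimes>\<^sub>M distr M T' (\<lambda>\<omega>. g (V \<omega>))"
    by (simp add: distr_distr comp_def)
  finally show ?thesis .
qed

section \<open>Moments of the kernel on an i.i.d. sample\<close>

text \<open>An arbitrary enumeration is enough: by \<open>W_tuple\<close>, the symmetry of the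
  kernel makes the value on \<open>S\<close> independent of the choice.\<close>

definition enum :: "nat \<Rightarrow> nat set \<Rightarrow> nat \<Rightarrow> nat" where
  "enum m S = (SOME f. bij_betw f {1..m} S)"

lemma bij_betw_enum: "finite S \<Longrightarrow> card S = m \<Longrightarrow> bij_betw (enum m S) {1..m} S"
  unfolding enum_def by (intro someI_ex[of "\<lambda>f. bij_betw f {1..m} S"]) (metis ex_bij_betw_nat_finite_1)

text \<open>One sample with one kernel. The condition \<open>2 * m \<le> n\<close> leaves room for
  two m-sets meeting in a point and for at least one block of length \<open>2 * m - 1\<close>;
  \<open>B \<ge> 1\<close> allows \<open>B\<^sup>2\<close> and \<open>B ^ 4\<close> to be compared,
  and callers pass \<open>max 1 B\<close>.\<close>

locale iid_kernel = prob_space M for M :: "'w measure" +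
  fixes d m n :: nat and B :: real and P :: "(nat \<Rightarrow> real) measure"
    and X :: "nat \<Rightarrow> 'w \<Rightarrow> nat \<Rightarrow> real" and \<Phi> :: "(nat \<Rightarrow> nat \<Rightarrow> real) \<Rightarrow> real"
  assumes m: "m \<ge> 1" and n: "2 * m \<le> n" and B: "B \<ge> 1"
    and iid: "iid_copies M d P {1..n} X" and sym: "symmetric_kernel d m \<Phi>"
    and bound: "\<And>x. x \<in> space (Rdm d m) \<Longrightarrow> \<bar>\<Phi> x\<bar> \<le> B"
begin

abbreviation "A \<equiv> {1..n}"

lemma indep: "indep_vars (\<lambda>_. Rd d) X A"
  using iid by (simp add: iid_copies_def)

lemma X_meas [measurable]: "l \<in> A \<Longrightarrow> X l \<in> measurable M (Rd d)"
  using indep by (simp add: indep_vars_def)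

lemma distr_X: "l \<in> A \<Longrightarrow> distr M (Rd d) (X l) = P"
  using iid by (simp add: iid_copies_def)

lemma sets_P: "sets P = sets (Rd d)"
  using distr_X[of 1] n m by (metis atLeastAtMost_iff le_refl le_trans mult_2 le_add1 sets_distr)

lemma prob_space_P: "prob_space P"
  using distr_X[of 1] X_meas[of 1] prob_space_distr[of "X 1" "Rd d"] n m by auto

lemma \<Phi>_meas [measurable]: "\<Phi> \<in> borel_measurable (PiM {1..m} (\<lambda>_. Rd d))"
  using sym by (simp add: symmetric_kernel_def Rdm_def)

definition W :: "nat set \<Rightarrow> 'w \<Rightarrow> real" where
  "W S \<omega> = \<Phi> (\<lambda>k\<in>{1..m}. X (enum m S k) \<omega>)"

text \<open>
  \<open>kern S\<close> reads \<open>W S\<close> off any subfamily of the sample containing \<open>S\<close>, so that independence of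
  disjoint subfamilies carries over to \<open>W\<close>.
\<close>

definition kern :: "nat set \<Rightarrow> (nat \<Rightarrow> nat \<Rightarrow> real) \<Rightarrow> real" where
  "kern S x = \<Phi> (\<lambda>k\<in>{1..m}. x (enum m S k))"

lemma enum: "S \<in> subsets m A \<Longrightarrow> bij_betw (enum m S) {1..m} S"
  by (rule bij_betw_enum) (auto simp: subsets_def intro: finite_subset)

lemma tuple_meas:
  assumes "f \<in> J \<rightarrow> A"
  shows "(\<lambda>\<omega>. \<lambda>j\<in>J. X (f j) \<omega>) \<in> measurable M (PiM J (\<lambda>_. Rd d))"
  using assms by (intro measurable_restrict X_meas) blast

text \<open>Two enumerations of \<open>S\<close> differ by a permutation of \<open>{1..m}\<close>,
  here \<pi>, extended by the identity.\<close>

lemma W_tuple: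
  assumes S: "S \<in> subsets m A" and f: "bij_betw f {1..m} S" and \<omega>: "\<omega> \<in> space M"
  shows "\<Phi> (\<lambda>k\<in>{1..m}. X (f k) \<omega>) = W S \<omega>"
proof -
  let ?e = "enum m S"
  define \<pi> where "\<pi> k = (if k \<in> {1..m} then inv_into {1..m} ?e (f k) else k)" for k
  have e: "bij_betw ?e {1..m} S" using S by (rule enum)
  have "bij_betw (inv_into {1..m} ?e \<circ> f) {1..m} {1..m}"
    by (rule bij_betw_trans[OF f bij_betw_inv_into[OF e]])
  hence "bij_betw \<pi> {1..m} {1..m}"
    by (rule bij_betw_cong[THEN iffD1, rotated]) (simp add: \<pi>_def)
  hence \<pi>: "\<pi> permutes {1..m}"
    by (rule bij_imp_permutes) (simp add: \<pi>_def del: atLeastAtMost_iff)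
  have e\<pi>: "?e (\<pi> k) = f k" if "k \<in> {1..m}" for k
    using that bij_betw_apply[OF f that] e by (auto simp: \<pi>_def bij_betw_def f_inv_into_f)
  let ?x = "\<lambda>k\<in>{1..m}. X (?e k) \<omega>"
  have "?e \<in> {1..m} \<rightarrow> A" using e S by (auto simp: bij_betw_def subsets_def)
  hence x: "?x \<in> space (Rdm d m)"
    unfolding Rdm_def using measurable_space[OF tuple_meas \<omega>] by blast
  have "?x \<circ> \<pi> = (\<lambda>k\<in>{1..m}. X (f k) \<omega>)"
    using permutes_in_image[OF \<pi>] e\<pi> by (auto simp: fun_eq_iff restrict_def)
  thus ?thesis using sym \<pi> x unfolding symmetric_kernel_def W_def by metis
qed

lemma kern_meas:
  assumes S: "S \<in> subsets m A" and D: "S \<subseteq> D"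
  shows "kern S \<in> borel_measurable (PiM D (\<lambda>_. Rd d))"
proof -
  have "enum m S k \<in> D" if "k \<in> {1..m}" for k
    using bij_betw_apply[OF enum[OF S] that] D by auto
  hence "(\<lambda>x. \<lambda>k\<in>{1..m}. x (enum m S k)) \<in> measurable (PiM D (\<lambda>_. Rd d)) (PiM {1..m} (\<lambda>_. Rd d))"
    by (intro measurable_restrict measurable_component_singleton)
  from measurable_compose[OF this \<Phi>_meas] show ?thesis
    by (simp add: kern_def[abs_def])
qed

lemma kern_restrict:
  assumes S: "S \<in> subsets m A" and D: "S \<subseteq> D"
  shows "kern S (\<lambda>l\<in>D. X l \<omega>) = W S \<omega>"
proof -
  have "enum m S k \<in> D" if "k \<in> {1..m}" for k
    using bij_betw_apply[OF enum[OF S] that] D by auto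
  hence "(\<lambda>k\<in>{1..m}. (\<lambda>l\<in>D. X l \<omega>) (enum m S k)) = (\<lambda>k\<in>{1..m}. X (enum m S k) \<omega>)"
    by (intro restrict_ext) auto
  thus ?thesis by (simp only: kern_def W_def)
qed

lemma W_bound:
  assumes S: "S \<in> subsets m A" and \<omega>: "\<omega> \<in> space M"
  shows "\<bar>W S \<omega>\<bar> \<le> B"
proof -
  have "enum m S \<in> {1..m} \<rightarrow> A"
    using enum[OF S] S by (auto simp: bij_betw_def subsets_def)
  thus ?thesis
    unfolding W_def using bound measurable_space[OF tuple_meas \<omega>] unfolding Rdm_def by blast
qed

lemma W_meas [measurable]:
  assumes S: "S \<in> subsets m A"
  shows "W S \<in> borel_measurable M"
proof -
  have "enum m S \<in> {1..m} \<rightarrow> A"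
    using enum[OF S] S by (auto simp: bij_betw_def subsets_def)
  from measurable_compose[OF tuple_meas[OF this] \<Phi>_meas] show ?thesis
    by (simp add: W_def[abs_def])
qed

lemma W_mult_bound:
  assumes "S \<in> subsets m A" "T \<in> subsets m A" "\<omega> \<in> space M"
  shows "\<bar>W S \<omega> * W T \<omega>\<bar> \<le> B\<^sup>2"
  using W_bound[OF assms(1,3)] W_bound[OF assms(2,3)] B
  by (auto simp: abs_mult power2_eq_square intro!: mult_mono)

lemma integrable_W:
  assumes "S \<in> subsets m A"
  shows "integrable M (W S)"
  using assms W_bound by (intro integrable_const_bound[where B = B] AE_I2) auto

lemma integrable_W_mult:
  assumes "S \<in> subsets m A" "T \<in> subsets m A"
  shows "integrable M (\<lambda>\<omega>. W S \<omega> * W T \<omega>)"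
  using assms W_mult_bound by (intro integrable_const_bound[where B = "B\<^sup>2"] AE_I2) auto

text \<open>Distinct indices select coordinates of the product law of the whole sample. Hence a
  moment depends only on which arguments coincide, not on the sample indices themselves.\<close>

lemma distr_tuple:
  assumes f: "inj_on f J" "f \<in> J \<rightarrow> A"
  shows "distr M (PiM J (\<lambda>_. Rd d)) (\<lambda>\<omega>. \<lambda>j\<in>J. X (f j) \<omega>) = PiM J (\<lambda>_. P)"
proof -
  have ne: "A \<noteq> {}" using n m by auto
  have PA: "distr M (PiM A (\<lambda>_. Rd d)) (\<lambda>\<omega>. \<lambda>l\<in>A. X l \<omega>) = PiM A (\<lambda>_. P)"
    using indep_vars_iff_distr_eq_PiM'[OF ne, where M' = "\<lambda>_. Rd d" and X = X] indep X_meas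
    by (simp only: distr_X simp_thms cong: PiM_cong)
  have "(\<lambda>\<omega>. \<lambda>j\<in>J. \<omega> (f j)) \<in> measurable (PiM A (\<lambda>_. Rd d)) (PiM J (\<lambda>_. Rd d))"
    using f by (intro measurable_restrict measurable_component_singleton) auto
  moreover have "(\<lambda>\<omega>. \<lambda>l\<in>A. X l \<omega>) \<in> measurable M (PiM A (\<lambda>_. Rd d))"
    by (intro measurable_restrict) auto
  ultimately have "distr (PiM A (\<lambda>_. P)) (PiM J (\<lambda>_. Rd d)) (\<lambda>\<omega>. \<lambda>j\<in>J. \<omega> (f j)) =
      distr M (PiM J (\<lambda>_. Rd d)) ((\<lambda>\<omega>. \<lambda>j\<in>J. \<omega> (f j)) \<circ> (\<lambda>\<omega>. \<lambda>l\<in>A. X l \<omega>))"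
    unfolding PA[symmetric] by (rule distr_distr)
  also have "(\<lambda>\<omega>. \<lambda>j\<in>J. \<omega> (f j)) \<circ> (\<lambda>\<omega>. \<lambda>l\<in>A. X l \<omega>) = (\<lambda>\<omega>. \<lambda>j\<in>J. X (f j) \<omega>)"
    using f by (auto simp: fun_eq_iff Pi_iff)
  also have "distr (PiM A (\<lambda>_. P)) (PiM J (\<lambda>_. Rd d)) (\<lambda>\<omega>. \<lambda>j\<in>J. \<omega> (f j)) =
      distr (PiM A (\<lambda>_. P)) (PiM J (\<lambda>_. P)) (\<lambda>\<omega>. \<lambda>j\<in>J. \<omega> (f j))"
    by (intro distr_cong) (simp_all add: sets_P cong: sets_PiM_cong)
  also have "\<dots> = PiM J (\<lambda>_. P)"
    using f by (intro distr_PiM_reindex) (auto simp: prob_space_P)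
  finally show ?thesis ..
qed

lemma expectation_tuple:
  fixes h :: "_ \<Rightarrow> real"
  assumes f: "inj_on f J" "f \<in> J \<rightarrow> A" and h: "h \<in> borel_measurable (PiM J (\<lambda>_. Rd d))"
  shows "expectation (\<lambda>\<omega>. h (\<lambda>j\<in>J. X (f j) \<omega>)) = (\<integral>x. h x \<partial>PiM J (\<lambda>_. P))"
  unfolding distr_tuple[OF f, symmetric]
  by (rule integral_distr[symmetric, OF tuple_meas[OF f(2)] h])

definition \<theta> :: real where "\<theta> = (\<integral>x. \<Phi> x \<partial>PiM {1..m} (\<lambda>_. P))"

lemma expectation_W:
  assumes S: "S \<in> subsets m A"
  shows "expectation (W S) = \<theta>"
  unfolding W_def[abs_def] \<theta>_def
  using enum[OF S] S by (intro expectation_tuple \<Phi>_meas) (auto simp: bij_betw_def subsets_def)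

text \<open>
  In \<open>\<gamma>\<close> the second factor shares the first point and otherwise uses the fresh points
  \<open>m + 1, \<dots>, 2 * m - 1\<close>, which \<open>skip\<close> selects.
\<close>

definition skip :: "nat \<Rightarrow> nat" where "skip k = (if k = 1 then 1 else k + m - 1)"

definition \<gamma> :: real where
  "\<gamma> = (\<integral>x. \<Phi> (\<lambda>k\<in>{1..m}. x k) * \<Phi> (\<lambda>k\<in>{1..m}. x (skip k)) \<partial>PiM {1..2 * m - 1} (\<lambda>_. P))"

lemma bij_betw_skip: "bij_betw skip {2..m} {m + 1..2 * m - 1}"
proof -
  have "bij_betw (\<lambda>k. k + (m - 1)) {2..m} {2 + (m - 1)..m + (m - 1)}"
    using image_add_atLeastAtMost'[of "m - 1" 2 m] by (simp add: bij_betw_def inj_on_def)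
  moreover have "2 + (m - 1) = m + 1" "m + (m - 1) = 2 * m - 1" using m by auto
  ultimately have "bij_betw (\<lambda>k. k + (m - 1)) {2..m} {m + 1..2 * m - 1}" by simp
  thus ?thesis
    by (rule bij_betw_cong[THEN iffD1, rotated]) (use m in \<open>auto simp: skip_def\<close>)
qed

lemma skip_mem: "k \<in> {1..m} \<Longrightarrow> skip k \<in> {1..2 * m - 1}"
  using m by (auto simp: skip_def)

text \<open>One injection \<open>f\<close> of \<open>{1..2 * m - 1}\<close> brings every such pair
  into the standard position of \<gamma>: it sends 1 to the common point, \<open>{2..m}\<close> onto
  the rest of \<open>S\<close> and the remaining indices onto the rest of \<open>T\<close>. Then
  \<open>f\<close> enumerates \<open>S\<close>, and \<open>f \<circ> skip\<close> enumerates
  \<open>T\<close>.\<close>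

lemma expectation_W_mult_meet_once:
  assumes S: "S \<in> subsets m A" and T: "T \<in> subsets m A" and ST: "card (S \<inter> T) = 1"
  shows "expectation (\<lambda>\<omega>. W S \<omega> * W T \<omega>) = \<gamma>"
proof -
  obtain a where a: "S \<inter> T = {a}" using ST by (rule card_1_singletonE)
  have fin: "finite S" "finite T" "card S = m" "card T = m" "S \<subseteq> A" "T \<subseteq> A"
    using S T by (auto simp: subsets_def intro: finite_subset)
  have aST: "a \<in> S" "a \<in> T" using a by auto
  have "card (S - {a}) = card {2..m}" "card (T - {a}) = card {m + 1..2 * m - 1}"
    using fin aST by simp_all
  then obtain g g' where g: "bij_betw g {2..m} (S - {a})" and g': "bij_betw g' {m + 1..2 * m - 1} (T - {a})"
    using finite_same_card_bij[of "{2..m}" "S - {a}"] finite_same_card_bij[of "{m + 1..2 * m - 1}" "T - {a}"] fin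
    by auto
  define f where "f j = (if j = 1 then a else if j \<le> m then g j else g' j)" for j
  have f1: "bij_betw f {1} {a}" by (simp add: f_def bij_betw_def)
  have f2: "bij_betw f {2..m} (S - {a})"
    using g by (rule bij_betw_cong[THEN iffD1, rotated]) (auto simp: f_def)
  have f3: "bij_betw f {m + 1..2 * m - 1} (T - {a})"
    using g' by (rule bij_betw_cong[THEN iffD1, rotated]) (use m in \<open>auto simp: f_def\<close>)
  have f12: "bij_betw f ({1} \<union> {2..m}) ({a} \<union> (S - {a}))"
    by (rule bij_betw_combine[OF f1 f2]) auto
  have "bij_betw f ({1} \<union> {2..m} \<union> {m + 1..2 * m - 1}) ({a} \<union> (S - {a}) \<union> (T - {a}))"
    by (rule bij_betw_combine[OF f12 f3]) (use a in auto)
  moreover have eq1: "{1} \<union> {2..m} = {1..m}" "{a} \<union> (S - {a}) = S" "{a} \<union> (T - {a}) = T"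
    using m aST by auto
  moreover have "{1..m} \<union> {m + 1..2 * m - 1} = {1..2 * m - 1}" using m by auto
  ultimately have "bij_betw f {1..2 * m - 1} (S \<union> (T - {a}))" by (simp only:)
  hence f: "inj_on f {1..2 * m - 1}" "f \<in> {1..2 * m - 1} \<rightarrow> A"
    using fin by (auto simp: bij_betw_def)
  have fS: "bij_betw f {1..m} S" using f12 eq1 by simp
  have s1: "bij_betw (f \<circ> skip) {1} {a}" by (simp add: f_def bij_betw_def skip_def)
  have "bij_betw (f \<circ> skip) ({1} \<union> {2..m}) ({a} \<union> (T - {a}))"
    by (rule bij_betw_combine[OF s1 bij_betw_trans[OF bij_betw_skip f3]]) auto
  hence fT: "bij_betw (f \<circ> skip) {1..m} T" using eq1 by simp
  let ?h = "\<lambda>x. \<Phi> (\<lambda>k\<in>{1..m}. x k) * \<Phi> (\<lambda>k\<in>{1..m}. x (skip k))"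
  let ?R = "PiM {1..2 * m - 1} (\<lambda>_. Rd d)"
  have "(\<lambda>x. \<lambda>k\<in>{1..m}. x k) \<in> measurable ?R (PiM {1..m} (\<lambda>_. Rd d))"
    "(\<lambda>x. \<lambda>k\<in>{1..m}. x (skip k)) \<in> measurable ?R (PiM {1..m} (\<lambda>_. Rd d))"
    using skip_mem by (auto intro!: measurable_restrict measurable_component_singleton)
  from this[THEN measurable_compose[OF _ \<Phi>_meas]] have h: "?h \<in> borel_measurable ?R"
    by measurable
  have "expectation (\<lambda>\<omega>. W S \<omega> * W T \<omega>) = expectation (\<lambda>\<omega>. ?h (\<lambda>j\<in>{1..2 * m - 1}. X (f j) \<omega>))"
  proof (rule Bochner_Integration.integral_cong[OF refl])
    fix \<omega> assume \<omega>: "\<omega> \<in> space M"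
    let ?x = "\<lambda>j\<in>{1..2 * m - 1}. X (f j) \<omega>"
    have "(\<lambda>k\<in>{1..m}. ?x k) = (\<lambda>k\<in>{1..m}. X (f k) \<omega>)"
      by (intro restrict_ext) auto
    moreover have "(\<lambda>k\<in>{1..m}. ?x (skip k)) = (\<lambda>k\<in>{1..m}. X ((f \<circ> skip) k) \<omega>)"
      using skip_mem by (intro restrict_ext) (simp del: atLeastAtMost_iff)
    ultimately show "W S \<omega> * W T \<omega> = ?h ?x"
      using W_tuple[OF S fS \<omega>] W_tuple[OF T fT \<omega>] by (simp only:)
  qed
  also have "\<dots> = \<gamma>" unfolding \<gamma>_def by (rule expectation_tuple[OF f h])
  finally show ?thesis .
qed

lemma expectation_W_mult_disjoint:
  assumes S: "S \<in> subsets m A" and T: "T \<in> subsets m A" and ST: "S \<inter> T = {}"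
  shows "expectation (\<lambda>\<omega>. W S \<omega> * W T \<omega>) = \<theta>\<^sup>2"
proof -
  have "indep_var (PiM S (\<lambda>_. Rd d)) (\<lambda>\<omega>. \<lambda>l\<in>S. X l \<omega>) (PiM T (\<lambda>_. Rd d)) (\<lambda>\<omega>. \<lambda>l\<in>T. X l \<omega>)"
    by (rule indep_var_restrict[OF indep ST]) (use S T in \<open>auto simp: subsets_def\<close>)
  from indep_var_compose[OF this kern_meas[OF S subset_refl] kern_meas[OF T subset_refl]]
  have "indep_var borel (W S) borel (W T)"
    by (simp add: comp_def kern_restrict[OF S subset_refl] kern_restrict[OF T subset_refl])
  from indep_var_lebesgue_integral[OF this integrable_W[OF S] integrable_W[OF T]] show ?thesis
    by (simp only: expectation_W[OF S] expectation_W[OF T] power2_eq_square)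
qed

text \<open>An instance of \<open>variance_cond_exp\<close>: \<open>?Y\<close> holds the sample
  points 2 to m, and the copy \<open>?Y'\<close> the points m + 1 to 2m - 1, relabelled by
  \<open>skip\<close> so that both live in \<open>?L\<close>. For m = 1 both tuples are
  empty.\<close>

lemma zeta_eq: "zeta M d m \<Phi> X = \<gamma> - \<theta>\<^sup>2"
proof -
  let ?L = "PiM {2..m} (\<lambda>_. Rd d)"
  let ?Y = "\<lambda>\<omega>. \<lambda>k\<in>{2..m}. X k \<omega>" and ?Y' = "\<lambda>\<omega>. \<lambda>k\<in>{2..m}. X (skip k) \<omega>"
  let ?\<phi> = "\<lambda>(x, y). \<Phi> (\<lambda>k\<in>{1..m}. if k = 1 then x else y k)"
  have mem: "1 \<in> A" "{2..m} \<subseteq> A" "{2..2 * m - 1} \<subseteq> A" "skip ` {2..m} \<subseteq> A"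
    "{1..m} \<in> subsets m A"
    using m n bij_betw_skip by (auto simp: bij_betw_def subsets_def)
  have X1: "X 1 \<in> measurable M (Rd d)" using mem by simp
  have Y: "?Y \<in> measurable M ?L" "?Y' \<in> measurable M ?L"
    using mem by (auto intro!: measurable_restrict X_meas)
  have r: "(\<lambda>x. \<lambda>k\<in>J. x (f k)) \<in> measurable (PiM I (\<lambda>_. Rd d)) (PiM J (\<lambda>_. Rd d))"
    if "f ` J \<subseteq> I" for f :: "nat \<Rightarrow> nat" and I J
    using that by (intro measurable_restrict measurable_component_singleton) auto
  have restr: "(\<lambda>k\<in>{2..m}. (\<lambda>l\<in>J. X l \<omega>) (f k)) = (\<lambda>k\<in>{2..m}. X (f k) \<omega>)"
    if "f ` {2..m} \<subseteq> J" for f J \<omega>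
    using that by (intro restrict_ext) (simp add: image_subset_iff)
  have sk: "skip ` {2..m} \<subseteq> {m + 1..2 * m - 1}" "skip ` {2..m} \<subseteq> {2..2 * m - 1}"
    "(\<lambda>k. k) ` {2..m} \<subseteq> {2..2 * m - 1}"
    using bij_betw_skip by (auto simp: bij_betw_def)
  \<comment> \<open>The joint law is factored in two stages: \<open>j1\<close> separates
    \<open>?Y\<close> from \<open>?Y'\<close>, then \<open>j2\<close> separates the first point from
    the pair. The two remaining factors agree by \<open>same\<close>.\<close>
  have "indep_var (PiM {2..m} (\<lambda>_. Rd d)) (\<lambda>\<omega>. \<lambda>l\<in>{2..m}. X l \<omega>)
      (PiM {m + 1..2 * m - 1} (\<lambda>_. Rd d)) (\<lambda>\<omega>. \<lambda>l\<in>{m + 1..2 * m - 1}. X l \<omega>)"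
    by (rule indep_var_restrict[OF indep]) (use n in auto)
  from indep_var_distr_pair[OF this measurable_ident r[OF sk(1)]]
  have j1: "distr M (?L \<Otimes>\<^sub>M ?L) (\<lambda>\<omega>. (?Y \<omega>, ?Y' \<omega>)) = distr M ?L ?Y \<Otimes>\<^sub>M distr M ?L ?Y'"
    by (simp only: restr[OF sk(1)] id_apply)
  have "indep_var (PiM {1} (\<lambda>_. Rd d)) (\<lambda>\<omega>. \<lambda>l\<in>{1}. X l \<omega>)
      (PiM {2..2 * m - 1} (\<lambda>_. Rd d)) (\<lambda>\<omega>. \<lambda>l\<in>{2..2 * m - 1}. X l \<omega>)"
    by (rule indep_var_restrict[OF indep]) (use mem in auto)
  from indep_var_distr_pair[OF this measurable_component_singleton
      measurable_Pair[OF r[OF sk(3)] r[OF sk(2)]], of 1]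
  have j2: "distr M (Rd d \<Otimes>\<^sub>M (?L \<Otimes>\<^sub>M ?L)) (\<lambda>\<omega>. (X 1 \<omega>, ?Y \<omega>, ?Y' \<omega>)) =
     distr M (Rd d) (X 1) \<Otimes>\<^sub>M distr M (?L \<Otimes>\<^sub>M ?L) (\<lambda>\<omega>. (?Y \<omega>, ?Y' \<omega>))"
    by (simp only: restr[OF sk(2)] restr[OF sk(3)] restrict_apply' insertI1 simp_thms True_implies_equals)
  have "distr M ?L ?Y' = PiM {2..m} (\<lambda>_. P)"
  proof (rule distr_tuple)
    show "inj_on skip {2..m}" using bij_betw_skip by (simp add: bij_betw_def)
    show "skip \<in> {2..m} \<rightarrow> A" using mem(4) by blast
  qed
  moreover have "distr M ?L ?Y = PiM {2..m} (\<lambda>_. P)"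
    using mem(2) by (intro distr_tuple[of "\<lambda>k. k"]) auto
  ultimately have same: "distr M ?L ?Y' = distr M ?L ?Y" by (simp only:)
  have joint: "distr M (Rd d \<Otimes>\<^sub>M (?L \<Otimes>\<^sub>M ?L)) (\<lambda>\<omega>. (X 1 \<omega>, ?Y \<omega>, ?Y' \<omega>)) =
     distr M (Rd d) (X 1) \<Otimes>\<^sub>M (distr M ?L ?Y \<Otimes>\<^sub>M distr M ?L ?Y)"
    using j1 j2 by (simp only: same)
  have arg: "(\<lambda>z. \<lambda>k\<in>{1..m}. if k = 1 then fst z else snd z k)
      \<in> measurable (Rd d \<Otimes>\<^sub>M ?L) (PiM {1..m} (\<lambda>_. Rd d))"
  proof (rule measurable_restrict)
    fix k assume k: "k \<in> {1..m}"
    show "(\<lambda>z. if k = 1 then fst z else snd z k) \<in> measurable (Rd d \<Otimes>\<^sub>M ?L) (Rd d)"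
    proof (cases "k = 1")
      case False
      hence "k \<in> {2..m}" using k by auto
      from measurable_compose[OF measurable_snd measurable_component_singleton[OF this]] False
      show ?thesis by simp
    qed simp
  qed
  have \<phi>: "?\<phi> \<in> borel_measurable (Rd d \<Otimes>\<^sub>M ?L)"
    using measurable_compose[OF arg \<Phi>_meas] by (simp add: case_prod_beta')
  have \<phi>_bound: "\<bar>?\<phi> z\<bar> \<le> B" if "z \<in> space (Rd d \<Otimes>\<^sub>M ?L)" for z
    using bound measurable_space[OF arg that] by (simp add: Rdm_def case_prod_beta')
  have \<phi>Y: "?\<phi> (X 1 \<omega>, ?Y \<omega>) = \<Phi> (\<lambda>k\<in>{1..m}. X k \<omega>)" for \<omega>
    by (auto intro!: arg_cong[where f = \<Phi>])
  have \<phi>Y': "?\<phi> (X 1 \<omega>, ?Y' \<omega>) = \<Phi> (\<lambda>k\<in>{1..m}. X (skip k) \<omega>)" for \<omega>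
    by (auto intro!: arg_cong[where f = \<Phi>] simp: skip_def)
  let ?T = "insert 1 {m + 1..2 * m - 1}"
  have T: "?T \<in> subsets m A" using m n by (auto simp: subsets_def)
  have "bij_betw skip {1} {1}" by (simp add: skip_def bij_betw_def)
  from bij_betw_combine[OF this bij_betw_skip] have "bij_betw skip ({1} \<union> {2..m}) ?T"
    using m by auto
  moreover have "{1} \<union> {2..m} = {1..m}" using m by auto
  ultimately have shT: "bij_betw skip {1..m} ?T" by simp
  have W1: "\<Phi> (\<lambda>k\<in>{1..m}. X k \<omega>) = W {1..m} \<omega>" if "\<omega> \<in> space M" for \<omega>
    using W_tuple[OF mem(5) _ that, of "\<lambda>k. k"] by (simp add: bij_betw_def)
  have W2: "\<Phi> (\<lambda>k\<in>{1..m}. X (skip k) \<omega>) = W ?T \<omega>" if "\<omega> \<in> space M" for \<omega>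
    by (rule W_tuple[OF T shT that])
  have "{1..m} \<inter> ?T = {1}" using m by auto
  hence E2: "expectation (\<lambda>\<omega>. W {1..m} \<omega> * W ?T \<omega>) = \<gamma>"
    by (intro expectation_W_mult_meet_once mem T) simp
  have "zeta M d m \<Phi> X = variance (real_cond_exp M (vimage_algebra (space M) (X 1) (Rd d))
      (\<lambda>\<omega>. ?\<phi> (X 1 \<omega>, ?Y \<omega>)))"
    by (simp only: zeta_def \<phi>Y)
  also have "\<dots> = expectation (\<lambda>\<omega>. ?\<phi> (X 1 \<omega>, ?Y \<omega>) * ?\<phi> (X 1 \<omega>, ?Y' \<omega>)) -
      (expectation (\<lambda>\<omega>. ?\<phi> (X 1 \<omega>, ?Y \<omega>)))\<^sup>2"
    by (rule variance_cond_exp[OF X1 Y joint \<phi> \<phi>_bound])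
  also have "\<dots> = expectation (\<lambda>\<omega>. W {1..m} \<omega> * W ?T \<omega>) - (expectation (W {1..m}))\<^sup>2"
    unfolding \<phi>Y \<phi>Y' using W1 W2 by (simp cong: Bochner_Integration.integral_cong)
  finally show ?thesis using E2 mem by (simp add: expectation_W)
qed

end

section \<open>Concentration and variance\<close>

text \<open>The deterministic error of the scaled jackknife estimator. The first summand is the cost
  of replacing n (n - 1) / (n - m)^2 by 1, the second the cost of discarding overlapping pairs
  \<open>R\<close>, \<open>R'\<close>.\<close>

definition jack_bias :: "nat \<Rightarrow> nat \<Rightarrow> real \<Rightarrow> real" where
  "jack_bias m n B = (real m)\<^sup>2 * (2 * B\<^sup>2) *
     (\<bar>real n * (real n - 1) / (real n - real m)\<^sup>2 - 1\<bar> +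
      (1 - real ((n - m) choose (m - 1)) / real ((n - 1) choose (m - 1))))"

context iid_kernel
begin

section \<open>The statistics as sums over index sets\<close>

lemma ustat_eq:
  assumes \<omega>: "\<omega> \<in> space M"
  shows "ustat m n \<Phi> X \<omega> = (\<Sum>S\<in>subsets m A. W S \<omega>) / real (n choose m)"
proof -
  have bij: "bij_betw (\<lambda>l. l ` {1..m}) (incr_tuples m A) (subsets m A)"
    by (rule bij_betw_incr_tuples) simp
  have "(\<Sum>l\<in>incr_tuples m A. \<Phi> (\<lambda>k\<in>{1..m}. X (l k) \<omega>)) = (\<Sum>l\<in>incr_tuples m A. W (l ` {1..m}) \<omega>)"
  proof (rule sum.cong[OF refl])
    fix l assume l: "l \<in> incr_tuples m A"
    show "\<Phi> (\<lambda>k\<in>{1..m}. X (l k) \<omega>) = W (l ` {1..m}) \<omega>"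
      using bij l incr_tuples_inj[OF l] \<omega>
      by (intro W_tuple) (auto simp: bij_betw_def)
  qed
  also have "\<dots> = (\<Sum>S\<in>subsets m A. W S \<omega>)"
    by (rule sum.reindex_bij_betw[OF bij])
  finally show ?thesis by (simp add: ustat_def)
qed

lemma insert_subsets:
  assumes "a \<in> A" "R \<in> subsets (m - 1) (A - {a})"
  shows "insert a R \<in> subsets m A"
proof -
  have "finite R" "a \<notin> R" using assms by (auto simp: subsets_def intro: finite_subset)
  thus ?thesis using assms m by (auto simp: subsets_def)
qed

lemma jack_comp_eq:
  assumes \<omega>: "\<omega> \<in> space M" and a: "a \<in> A"
  shows "jack_comp m n \<Phi> X a \<omega> =
    (\<Sum>R\<in>subsets (m - 1) (A - {a}). W (insert a R) \<omega>) / real ((n - 1) choose (m - 1))"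
proof -
  have bij: "bij_betw (\<lambda>l. l ` {1..m - 1}) (incr_tuples (m - 1) (A - {a})) (subsets (m - 1) (A - {a}))"
    by (rule bij_betw_incr_tuples) simp
  have "(\<Sum>l\<in>incr_tuples (m - 1) (A - {a}). \<Phi> (\<lambda>k\<in>{1..m}. if k = 1 then X a \<omega> else X (l (k - 1)) \<omega>)) =
     (\<Sum>l\<in>incr_tuples (m - 1) (A - {a}). W (insert a (l ` {1..m - 1})) \<omega>)"
  proof (rule sum.cong[OF refl])
    fix l assume l: "l \<in> incr_tuples (m - 1) (A - {a})"
    let ?f = "\<lambda>k. if k = 1 then a else l (k - 1)"
    have R: "l ` {1..m - 1} \<in> subsets (m - 1) (A - {a})"
      using bij l by (auto simp: bij_betw_def)
    have "bij_betw (\<lambda>k. k - 1) {2..m} {1..m - 1}"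
      by (rule bij_betw_byWitness[where f' = Suc]) auto
    moreover have "bij_betw l {1..m - 1} (l ` {1..m - 1})"
      using incr_tuples_inj[OF l] by (simp add: bij_betw_def)
    ultimately have "bij_betw (l \<circ> (\<lambda>k. k - 1)) {2..m} (l ` {1..m - 1})"
      by (rule bij_betw_trans)
    hence 2: "bij_betw ?f {2..m} (l ` {1..m - 1})"
      by (rule bij_betw_cong[THEN iffD1, rotated]) auto
    have 1: "bij_betw ?f {1} {a}" by (simp add: bij_betw_def)
    have "bij_betw ?f ({1} \<union> {2..m}) ({a} \<union> l ` {1..m - 1})"
      by (rule bij_betw_combine[OF 1 2]) (use R in \<open>auto simp: subsets_def\<close>)
    moreover have "{1} \<union> {2..m} = {1..m}" using m by auto
    ultimately have f: "bij_betw ?f {1..m} (insert a (l ` {1..m - 1}))" by simp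
    have "(\<lambda>k\<in>{1..m}. if k = 1 then X a \<omega> else X (l (k - 1)) \<omega>) = (\<lambda>k\<in>{1..m}. X (?f k) \<omega>)"
      by (intro restrict_ext) simp
    thus "\<Phi> (\<lambda>k\<in>{1..m}. if k = 1 then X a \<omega> else X (l (k - 1)) \<omega>) = W (insert a (l ` {1..m - 1})) \<omega>"
      using W_tuple[OF insert_subsets[OF a R] f \<omega>] by (simp only:)
  qed
  also have "\<dots> = (\<Sum>R\<in>subsets (m - 1) (A - {a}). W (insert a R) \<omega>)"
    by (rule sum.reindex_bij_betw[OF bij])
  finally show ?thesis by (simp add: jack_comp_def)
qed

lemma ustat_meas [measurable]: "ustat m n \<Phi> X \<in> borel_measurable M"
proof -
  have "(\<lambda>\<omega>. (\<Sum>S\<in>subsets m A. W S \<omega>) / real (n choose m)) \<in> borel_measurable M"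
    by (intro borel_measurable_divide borel_measurable_sum W_meas) auto
  thus ?thesis by (rule measurable_cong[THEN iffD2, rotated]) (rule ustat_eq)
qed

lemma jack_comp_meas [measurable]:
  assumes a: "a \<in> A"
  shows "jack_comp m n \<Phi> X a \<in> borel_measurable M"
proof -
  have "(\<lambda>\<omega>. (\<Sum>R\<in>subsets (m - 1) (A - {a}). W (insert a R) \<omega>) / real ((n - 1) choose (m - 1)))
     \<in> borel_measurable M"
    by (intro borel_measurable_divide borel_measurable_sum W_meas insert_subsets a) auto
  thus ?thesis by (rule measurable_cong[THEN iffD2, rotated]) (rule jack_comp_eq[OF _ a])
qed

lemma jack_var_meas [measurable]: "jack_var m n \<Phi> X \<in> borel_measurable M"
  unfolding jack_var_def[abs_def] by measurable

text \<open>Each m-set is counted m times, and the absorption identity for binomial coefficients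
  matches the two normalisations. As a result the squared deviations sum to the squares minus n
  u^2.\<close>

lemma sum_jack_comp:
  assumes \<omega>: "\<omega> \<in> space M"
  shows "(\<Sum>a\<in>A. jack_comp m n \<Phi> X a \<omega>) = real n * ustat m n \<Phi> X \<omega>"
proof -
  have "m * (n choose m) = n * ((n - 1) choose (m - 1))"
    using times_binomial_minus1_eq[of m n] m by simp
  hence c: "real m * real (n choose m) = real n * real ((n - 1) choose (m - 1))"
    by (simp flip: of_nat_mult)
  have pos: "n choose m > 0" "(n - 1) choose (m - 1) > 0" using m n by auto
  have "(\<Sum>a\<in>A. jack_comp m n \<Phi> X a \<omega>) =
     real m * (\<Sum>S\<in>subsets m A. W S \<omega>) / real ((n - 1) choose (m - 1))"
    using sum_insert_subsets[of A m "\<lambda>S. W S \<omega>"] m \<omega>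
    by (simp add: jack_comp_eq flip: sum_divide_distrib)
  also have "\<dots> = real n * ((\<Sum>S\<in>subsets m A. W S \<omega>) / real (n choose m))"
    using pos c by (simp add: field_simps)
  finally show ?thesis using \<omega> by (simp add: ustat_eq)
qed

section \<open>Disjoint sample blocks and exponential tail bounds\<close>

definition block :: "nat \<Rightarrow> nat set" where
  "block b = {b * (2 * m - 1) + 1..b * (2 * m - 1) + (2 * m - 1)}"

abbreviation "K \<equiv> n div (2 * m - 1)"

lemma K_pos: "K > 0"
  using m n by (simp add: div_greater_zero_iff)

lemma block_subset: "b < K \<Longrightarrow> block b \<subseteq> A"
proof -
  assume "b < K"
  hence "Suc b * (2 * m - 1) \<le> K * (2 * m - 1)" by (intro mult_right_mono) auto
  also have "\<dots> \<le> n" by (rule div_times_less_eq_dividend)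
  finally show ?thesis by (auto simp: block_def)
qed

lemma block_disjoint: "b \<noteq> b' \<Longrightarrow> block b \<inter> block b' = {}"
proof -
  have *: "block b \<inter> block b' = {}" if "b < b'" for b b'
  proof -
    have "Suc b * (2 * m - 1) \<le> b' * (2 * m - 1)" using that by (intro mult_right_mono) auto
    thus ?thesis by (auto simp: block_def)
  qed
  assume "b \<noteq> b'"
  thus ?thesis using *[of b b'] *[of b' b] by (cases "b < b'") auto
qed

text \<open>For fixed \<pi> the images of the blocks are disjoint, so the terms are independent in
  \<open>b\<close>; for fixed \<open>b\<close> the average over \<pi> is \<open>V\<close>.
  Exchanging the two averages puts \<open>V\<close> into the form required by
  \<open>Hoeffding_average\<close>. \<open>H\<close> exhibits \<open>Z\<close> as a function of the
  sample points in the permuted block, which is what transports independence.\<close>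

lemma permuted_block_concentration:
  fixes H :: "(nat \<Rightarrow> nat) \<Rightarrow> nat \<Rightarrow> (nat \<Rightarrow> nat \<Rightarrow> real) \<Rightarrow> real"
  assumes t: "t \<ge> 0" and c: "c > 0"
    and H: "\<And>\<pi> b. \<pi> permutes A \<Longrightarrow> b < K \<Longrightarrow> H \<pi> b \<in> borel_measurable (PiM (\<pi> ` block b) (\<lambda>_. Rd d))"
    and Z: "\<And>\<pi> b \<omega>. \<pi> permutes A \<Longrightarrow> b < K \<Longrightarrow> \<omega> \<in> space M \<Longrightarrow> H \<pi> b (\<lambda>l\<in>\<pi> ` block b. X l \<omega>) = Z \<pi> b \<omega>"
    and bnd: "\<And>\<pi> b \<omega>. \<pi> permutes A \<Longrightarrow> b < K \<Longrightarrow> \<omega> \<in> space M \<Longrightarrow> \<bar>Z \<pi> b \<omega>\<bar> \<le> c"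
    and mean: "\<And>\<pi> b. \<pi> permutes A \<Longrightarrow> b < K \<Longrightarrow> expectation (Z \<pi> b) = \<mu>"
    and avg: "\<And>b \<omega>. b < K \<Longrightarrow> \<omega> \<in> space M \<Longrightarrow>
      (\<Sum>\<pi> | \<pi> permutes A. Z \<pi> b \<omega>) / real (card {\<pi>. \<pi> permutes A}) = V \<omega>"
  shows "prob {\<omega>\<in>space M. \<bar>V \<omega> - \<mu>\<bar> \<ge> t} \<le> 2 * exp (- (real K * t\<^sup>2 / (2 * c\<^sup>2)))"
proof -
  let ?S = "{\<pi>. \<pi> permutes A}"
  have fin: "finite ?S" "?S \<noteq> {}"
    using finite_permutations[of A] permutes_id[of A] by blast+
  let ?Z = "\<lambda>\<pi> b \<omega>. H \<pi> b (\<lambda>l\<in>\<pi> ` block b. X l \<omega>)"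
  have V: "V \<omega> = (\<Sum>\<pi>\<in>?S. (\<Sum>b<K. ?Z \<pi> b \<omega>) / real K) / real (card ?S)" if \<omega>: "\<omega> \<in> space M" for \<omega>
  proof -
    have "(\<Sum>\<pi>\<in>?S. (\<Sum>b<K. ?Z \<pi> b \<omega>) / real K) / real (card ?S) =
      (\<Sum>\<pi>\<in>?S. (\<Sum>b<K. Z \<pi> b \<omega>) / real K) / real (card ?S)"
      using Z \<omega> by simp
    also have "\<dots> = (\<Sum>b<K. (\<Sum>\<pi>\<in>?S. Z \<pi> b \<omega>) / real (card ?S)) / real K"
      unfolding sum_divide_distrib by (subst sum.swap) (simp add: mult.commute)
    also have "\<dots> = V \<omega>" using avg \<omega> K_pos by simp
    finally show ?thesis ..
  qed
  have "prob {\<omega>\<in>space M. \<bar>V \<omega> - \<mu>\<bar> \<ge> t} =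
    prob {\<omega>\<in>space M. \<bar>(\<Sum>\<pi>\<in>?S. (\<Sum>b<K. ?Z \<pi> b \<omega>) / real K) / real (card ?S) - \<mu>\<bar> \<ge> t}"
    using V by (intro arg_cong[where f = prob] Collect_cong) auto
  also have "\<dots> \<le> 2 * exp (- (real K * t\<^sup>2 / (2 * c\<^sup>2)))"
  proof (rule Hoeffding_average[OF fin K_pos c t])
    fix \<pi> assume "\<pi> \<in> ?S"
    hence \<pi>: "\<pi> permutes A" by simp
    have "indep_vars (\<lambda>b. PiM (\<pi> ` block b) (\<lambda>_. Rd d)) (\<lambda>b \<omega>. \<lambda>l\<in>\<pi> ` block b. X l \<omega>) {..<K}"
    proof (rule indep_vars_restrict[OF indep])
      show "\<pi> ` block b \<subseteq> A" if "b \<in> {..<K}" for b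
        using block_subset[of b] that permutes_in_image[OF \<pi>] by auto
      show "disjoint_family_on (\<lambda>b. \<pi> ` block b) {..<K}"
        unfolding disjoint_family_on_def
        by (simp add: image_Int[OF permutes_inj[OF \<pi>], symmetric] block_disjoint)
    qed
    thus "indep_vars (\<lambda>_. borel) (?Z \<pi>) {..<K}"
      by (rule indep_vars_compose2) (use H[OF \<pi>] in auto)
    fix b assume b: "b < K"
    show "expectation (?Z \<pi> b) = \<mu>"
      using mean[OF \<pi> b] Z[OF \<pi> b] by (simp cong: Bochner_Integration.integral_cong)
    show "\<bar>?Z \<pi> b \<omega>\<bar> \<le> c" if "\<omega> \<in> space M" for \<omega>
      using bnd[OF \<pi> b that] Z[OF \<pi> b that] by simp
  qed
  finally show ?thesis .
qed

lemma permutes_subsets: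
  assumes \<pi>: "\<pi> permutes A" and S: "S \<in> subsets m A"
  shows "\<pi> ` S \<in> subsets m A"
  using S permutes_in_image[OF \<pi>] inj_on_subset[OF permutes_inj[OF \<pi>] subset_UNIV]
  by (auto simp: subsets_def card_image)

lemma ustat_concentration:
  assumes t: "t \<ge> 0"
  shows "prob {\<omega>\<in>space M. \<bar>ustat m n \<Phi> X \<omega> - \<theta>\<bar> \<ge> t} \<le> 2 * exp (- (real K * t\<^sup>2 / (2 * B\<^sup>2)))"
proof -
  \<comment> \<open>Only the first m points of a block enter; using the longer blocks here too gives
    the same \<open>K\<close> as for \<open>cross_avg\<close>.\<close>
  let ?S = "\<lambda>b. {b * (2 * m - 1) + 1..b * (2 * m - 1) + m}"
  have sub: "?S b \<subseteq> block b" for b using m by (auto simp: block_def)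
  have S: "?S b \<in> subsets m A" if "b < K" for b
    using subset_trans[OF sub block_subset[OF that]] by (simp only: subsets_def mem_Collect_eq) simp
  show ?thesis
  proof (rule permuted_block_concentration[where H = "\<lambda>\<pi> b. kern (\<pi> ` ?S b)" and Z = "\<lambda>\<pi> b. W (\<pi> ` ?S b)", OF t])
    show "B > 0" using B by simp
    fix \<pi> b assume \<pi>: "\<pi> permutes A" and b: "b < K"
    note pS = permutes_subsets[OF \<pi> S[OF b]]
    show "kern (\<pi> ` ?S b) \<in> borel_measurable (PiM (\<pi> ` block b) (\<lambda>_. Rd d))"
      by (rule kern_meas[OF pS]) (rule image_mono[OF sub])
    show "kern (\<pi> ` ?S b) (\<lambda>l\<in>\<pi> ` block b. X l \<omega>) = W (\<pi> ` ?S b) \<omega>" for \<omega>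
      by (rule kern_restrict[OF pS]) (rule image_mono[OF sub])
    show "\<bar>W (\<pi> ` ?S b) \<omega>\<bar> \<le> B" if "\<omega> \<in> space M" for \<omega>
      by (rule W_bound[OF pS that])
    show "expectation (W (\<pi> ` ?S b)) = \<theta>" by (rule expectation_W[OF pS])
  next
    fix b \<omega> assume b: "b < K" and \<omega>: "\<omega> \<in> space M"
    show "(\<Sum>\<pi> | \<pi> permutes A. W (\<pi> ` ?S b) \<omega>) / real (card {\<pi>. \<pi> permutes A}) = ustat m n \<Phi> X \<omega>"
      using average_over_permutations_subsets[OF _ S[OF b], of "\<lambda>S. W S \<omega>"] ustat_eq[OF \<omega>] by simp
  qed
qed

text \<open>The \<open>Q\<close> of the overview. Disjointness gives every summand the mean \<gamma>
  and makes the index set one orbit under permutations.\<close>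

definition cross_avg :: "'w \<Rightarrow> real" where
  "cross_avg \<omega> = (\<Sum>(a, R, R')\<in>disjoint_triples (m - 1) A. W (insert a R) \<omega> * W (insert a R') \<omega>) /
     real (card (disjoint_triples (m - 1) A))"

lemma triple_subsets:
  assumes "(a, R, R') \<in> disjoint_triples (m - 1) A"
  shows "insert a R \<in> subsets m A" "insert a R' \<in> subsets m A" "insert a R \<inter> insert a R' = {a}"
proof -
  have *: "a \<in> A" "R \<in> subsets (m - 1) (A - {a})" "R' \<in> subsets (m - 1) (A - {a})"
    and dis: "insert a R \<inter> insert a R' = {a}"
    using assms by (auto simp: disjoint_triples_iff subsets_def)
  show "insert a R \<in> subsets m A" "insert a R' \<in> subsets m A"
    using * insert_subsets by auto
  show "insert a R \<inter> insert a R' = {a}" by (rule dis)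
qed

lemma cross_avg_concentration:
  assumes t: "t \<ge> 0"
  shows "prob {\<omega>\<in>space M. \<bar>cross_avg \<omega> - \<gamma>\<bar> \<ge> t} \<le> 2 * exp (- (real K * t\<^sup>2 / (2 * (B\<^sup>2)\<^sup>2)))"
proof -
  \<comment> \<open>A block is cut into its first point, the next \<open>m - 1\<close> points and
    the last \<open>m - 1\<close> points, forming exactly one triple.\<close>
  let ?a = "\<lambda>b. b * (2 * m - 1) + 1"
  let ?R = "\<lambda>b. {b * (2 * m - 1) + 2..b * (2 * m - 1) + m}"
  let ?R' = "\<lambda>b. {b * (2 * m - 1) + m + 1..b * (2 * m - 1) + (2 * m - 1)}"
  let ?S = "\<lambda>\<pi> b. insert (\<pi> (?a b)) (\<pi> ` ?R b)" and ?T = "\<lambda>\<pi> b. insert (\<pi> (?a b)) (\<pi> ` ?R' b)"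
  have sub: "insert (?a b) (?R b) \<subseteq> block b" "insert (?a b) (?R' b) \<subseteq> block b" for b
    using m by (auto simp: block_def)
  have subp: "?S \<pi> b \<subseteq> \<pi> ` block b" "?T \<pi> b \<subseteq> \<pi> ` block b" for \<pi> b
    using sub[of b] by auto
  have tr: "(?a b, ?R b, ?R' b) \<in> disjoint_triples (m - 1) A" if "b < K" for b
    using block_subset[OF that] sub[of b] m unfolding disjoint_triples_iff by auto
  have trp: "(\<pi> (?a b), \<pi> ` ?R b, \<pi> ` ?R' b) \<in> disjoint_triples (m - 1) A" if b: "b < K" and \<pi>: "\<pi> permutes A" for b \<pi>
    using tr[OF b] permutes_in_image[OF \<pi>] inj_on_subset[OF permutes_inj[OF \<pi>] subset_UNIV]
    unfolding disjoint_triples_iff by (auto simp: card_image inj_eq[OF permutes_inj[OF \<pi>]])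
  show ?thesis
  proof (rule permuted_block_concentration[where H = "\<lambda>\<pi> b x. kern (?S \<pi> b) x * kern (?T \<pi> b) x"
        and Z = "\<lambda>\<pi> b \<omega>. W (?S \<pi> b) \<omega> * W (?T \<pi> b) \<omega>", OF t])
    show "B\<^sup>2 > 0" using B by simp
    fix \<pi> b assume \<pi>: "\<pi> permutes A" and b: "b < K"
    note p = triple_subsets[OF trp[OF b \<pi>]]
    show "(\<lambda>x. kern (?S \<pi> b) x * kern (?T \<pi> b) x) \<in> borel_measurable (PiM (\<pi> ` block b) (\<lambda>_. Rd d))"
      by (intro borel_measurable_times kern_meas p subp)
    show "kern (?S \<pi> b) (\<lambda>l\<in>\<pi> ` block b. X l \<omega>) * kern (?T \<pi> b) (\<lambda>l\<in>\<pi> ` block b. X l \<omega>) =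
       W (?S \<pi> b) \<omega> * W (?T \<pi> b) \<omega>" for \<omega>
      by (simp only: kern_restrict[OF p(1) subp(1)] kern_restrict[OF p(2) subp(2)])
    show "\<bar>W (?S \<pi> b) \<omega> * W (?T \<pi> b) \<omega>\<bar> \<le> B\<^sup>2" if "\<omega> \<in> space M" for \<omega>
      by (rule W_mult_bound[OF p(1,2) that])
    show "expectation (\<lambda>\<omega>. W (?S \<pi> b) \<omega> * W (?T \<pi> b) \<omega>) = \<gamma>"
      by (rule expectation_W_mult_meet_once[OF p(1,2)]) (simp only: p(3) card.insert, simp)
  next
    fix b \<omega> assume b: "b < K" and \<omega>: "\<omega> \<in> space M"
    show "(\<Sum>\<pi> | \<pi> permutes A. W (?S \<pi> b) \<omega> * W (?T \<pi> b) \<omega>) / real (card {\<pi>. \<pi> permutes A}) = cross_avg \<omega>"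
      using average_over_permutations_triples[OF _ tr[OF b],
          of "\<lambda>(a, R, R'). W (insert a R) \<omega> * W (insert a R') \<omega>"]
      unfolding cross_avg_def by simp
  qed
qed

lemma cross_avg_meas [measurable]: "cross_avg \<in> borel_measurable M"
proof -
  have "(\<lambda>\<omega>. case t of (a, R, R') \<Rightarrow> W (insert a R) \<omega> * W (insert a R') \<omega>) \<in> borel_measurable M"
    if "t \<in> disjoint_triples (m - 1) A" for t
    using that triple_subsets[of "fst t" "fst (snd t)" "snd (snd t)"]
    by (cases t) (simp only: prod.case fst_conv snd_conv, intro borel_measurable_times W_meas, simp_all only:)
  thus ?thesis
    unfolding cross_avg_def[abs_def] by (intro borel_measurable_divide borel_measurable_sum) auto
qed

text \<open>For fixed \<open>a\<close> and \<open>R\<close>, the fraction of the (m - 1)-subsets of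
  \<open>A - {a}\<close> that are disjoint from \<open>R\<close>.\<close>

definition p :: real where
  "p = real ((n - m) choose (m - 1)) / real ((n - 1) choose (m - 1))"

lemma ustat_bound:
  assumes \<omega>: "\<omega> \<in> space M"
  shows "\<bar>ustat m n \<Phi> X \<omega>\<bar> \<le> B"
proof -
  have "\<bar>\<Sum>S\<in>subsets m A. W S \<omega>\<bar> \<le> (\<Sum>S\<in>subsets m A. B)"
    using W_bound \<omega> by (intro order_trans[OF sum_abs] sum_mono) auto
  also have "\<dots> = real (n choose m) * B" by (simp add: card_subsets)
  finally show ?thesis using n m by (simp add: ustat_eq[OF \<omega>] field_simps abs_div)
qed

lemma \<theta>_bound: "\<bar>\<theta>\<bar> \<le> B"
proof -
  have S: "{1..m} \<in> subsets m A" using n by (auto simp: subsets_def)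
  have "\<bar>expectation (W {1..m})\<bar> \<le> expectation (\<lambda>\<omega>. \<bar>W {1..m} \<omega>\<bar>)"
    by (rule integral_abs_bound)
  also have "\<dots> \<le> expectation (\<lambda>\<omega>. B)"
    using integrable_W[OF S] W_bound[OF S] by (intro integral_mono) auto
  finally show ?thesis by (simp only: expectation_W[OF S]) (simp add: prob_space)
qed

text \<open>Expanding the squares gives a sum \<open>F\<close> over all pairs \<open>R\<close>,
  \<open>R'\<close>, while \<open>cross_avg\<close> uses the part \<open>D\<close> over disjoint
  pairs. Omitting the other pairs and changing the normalisation each cost at most
  \<open>B\<^sup>2 * (1 - p)\<close>.\<close>

lemma jack_square_sum:
  assumes \<omega>: "\<omega> \<in> space M"
  shows "\<bar>(\<Sum>a\<in>A. (jack_comp m n \<Phi> X a \<omega>)\<^sup>2) / real n - cross_avg \<omega>\<bar> \<le> 2 * B\<^sup>2 * (1 - p)"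
    and "\<bar>(\<Sum>a\<in>A. (jack_comp m n \<Phi> X a \<omega>)\<^sup>2) / real n\<bar> \<le> B\<^sup>2"
proof -
  define c1 c2 where "c1 = real ((n - 1) choose (m - 1))" and "c2 = real ((n - m) choose (m - 1))"
  let ?s = "\<lambda>a. subsets (m - 1) (A - {a})"
  let ?w = "\<lambda>a R R'. W (insert a R) \<omega> * W (insert a R') \<omega>"
  define D where "D = (\<Sum>a\<in>A. \<Sum>R\<in>?s a. \<Sum>R'\<in>subsets (m - 1) (A - {a} - R). ?w a R R')"
  define F where "F = (\<Sum>a\<in>A. \<Sum>R\<in>?s a. \<Sum>R'\<in>?s a. ?w a R R')"
  have n0: "n > 0" and c: "c1 > 0" "c2 > 0" using m n by (auto simp: c1_def c2_def)
  have card1: "real (card (?s a)) = c1" if "a \<in> A" for a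
    using that by (simp add: card_subsets c1_def)
  have card2: "real (card (subsets (m - 1) (A - {a} - R))) = c2" if "a \<in> A" "R \<in> ?s a" for a R
  proof -
    have "finite R" using that by (auto simp: subsets_def intro: finite_subset)
    hence "card (A - {a} - R) = n - 1 - (m - 1)"
      using that by (simp add: subsets_def card_Diff_subset)
    also have "\<dots> = n - m" using m by simp
    finally show ?thesis by (simp add: card_subsets c2_def)
  qed
  have wb: "\<bar>?w a R R'\<bar> \<le> B\<^sup>2" if "a \<in> A" "R \<in> ?s a" "R' \<in> ?s a" for a R R'
    by (rule W_mult_bound[OF insert_subsets insert_subsets \<omega>]) (rule that)+
  have sub: "subsets (m - 1) (A - {a} - R) \<subseteq> ?s a" for a R by (auto simp: subsets_def)
  have F: "(\<Sum>a\<in>A. (jack_comp m n \<Phi> X a \<omega>)\<^sup>2) / real n = F / (real n * c1\<^sup>2)"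
  proof -
    have "(jack_comp m n \<Phi> X a \<omega>)\<^sup>2 = (\<Sum>R\<in>?s a. \<Sum>R'\<in>?s a. ?w a R R') / c1\<^sup>2" if "a \<in> A" for a
      unfolding jack_comp_eq[OF \<omega> that] c1_def[symmetric] power_divide
      by (simp only: power2_eq_square[of "sum _ _"] sum_product)
    thus ?thesis by (simp add: F_def sum_divide_distrib mult.commute)
  qed
  have "real (card (disjoint_triples (m - 1) A)) = real n * c1 * c2"
    using m by (simp add: card_disjoint_triples c1_def c2_def)
  hence D: "cross_avg \<omega> = D / (real n * c1 * c2)"
    by (simp add: cross_avg_def sum_disjoint_triples D_def)
  have FD: "\<bar>F - D\<bar> \<le> real n * c1 * ((c1 - c2) * B\<^sup>2)"
  proof -
    have "\<bar>(\<Sum>R'\<in>?s a. ?w a R R') - (\<Sum>R'\<in>subsets (m - 1) (A - {a} - R). ?w a R R')\<bar> \<le> (c1 - c2) * B\<^sup>2"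
      if aR: "a \<in> A" "R \<in> ?s a" for a R
    proof -
      let ?r = "subsets (m - 1) (A - {a} - R)"
      have fin: "finite (?s a)" by simp
      have "(\<Sum>R'\<in>?s a. ?w a R R') - (\<Sum>R'\<in>?r. ?w a R R') = (\<Sum>R'\<in>?s a - ?r. ?w a R R')"
        using sum_diff[OF fin sub, of "?w a R"] by simp
      also have "\<bar>\<dots>\<bar> \<le> (\<Sum>R'\<in>?s a - ?r. B\<^sup>2)"
        using wb aR by (intro order_trans[OF sum_abs] sum_mono) auto
      also have "\<dots> = real (card (?s a - ?r)) * B\<^sup>2" by simp
      also have "real (card (?s a - ?r)) = real (card (?s a)) - real (card ?r)"
        using card_Diff_subset[OF finite_subset[OF sub fin] sub] card_mono[OF fin sub] by (simp add: of_nat_diff)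
      also have "\<dots> = c1 - c2" by (simp only: card1[OF aR(1)] card2[OF aR])
      finally show ?thesis .
    qed
    hence "\<bar>F - D\<bar> \<le> (\<Sum>a\<in>A. \<Sum>R\<in>?s a. (c1 - c2) * B\<^sup>2)"
      unfolding F_def D_def sum_subtractf[symmetric]
      by (intro order_trans[OF sum_abs] sum_mono)
    also have "\<dots> = real n * c1 * ((c1 - c2) * B\<^sup>2)"
      by (simp only: sum_constant card1 cong: sum.cong) simp
    finally show ?thesis .
  qed
  have "\<bar>D\<bar> \<le> (\<Sum>a\<in>A. \<Sum>R\<in>?s a. \<Sum>R'\<in>subsets (m - 1) (A - {a} - R). B\<^sup>2)"
    unfolding D_def using wb sub by (intro order_trans[OF sum_abs] sum_mono) blast
  also have "\<dots> = real n * c1 * c2 * B\<^sup>2"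
    by (simp only: sum_constant card1 card2 cong: sum.cong) simp
  finally have Db: "\<bar>D\<bar> \<le> real n * c1 * c2 * B\<^sup>2" .
  have "\<bar>F\<bar> \<le> (\<Sum>a\<in>A. \<Sum>R\<in>?s a. \<Sum>R'\<in>?s a. B\<^sup>2)"
    unfolding F_def using wb by (intro order_trans[OF sum_abs] sum_mono) blast
  also have "\<dots> = real n * c1\<^sup>2 * B\<^sup>2"
    by (simp only: sum_constant card1 cong: sum.cong) (simp add: power2_eq_square)
  finally show "\<bar>(\<Sum>a\<in>A. (jack_comp m n \<Phi> X a \<omega>)\<^sup>2) / real n\<bar> \<le> B\<^sup>2"
    unfolding F using n0 c by (simp add: abs_div field_simps)
  \<comment> \<open>The first term measures the omitted pairs, the second the passage from c1^2 to
    c1 c2 in the denominator.\<close>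
  have "F / (real n * c1\<^sup>2) - D / (real n * c1 * c2) =
      (F - D) / (real n * c1\<^sup>2) - D / (real n * c1 * c2) * (1 - c2 / c1)"
    using n0 c by (simp add: field_simps power2_eq_square)
  also have "\<bar>\<dots>\<bar> \<le> \<bar>(F - D) / (real n * c1\<^sup>2)\<bar> + \<bar>D / (real n * c1 * c2)\<bar> * \<bar>1 - c2 / c1\<bar>"
    by (intro order_trans[OF abs_triangle_ineq4]) (simp add: abs_mult)
  also have "\<dots> \<le> B\<^sup>2 * (1 - c2 / c1) + B\<^sup>2 * (1 - c2 / c1)"
  proof (intro add_mono mult_mono)
    show "\<bar>(F - D) / (real n * c1\<^sup>2)\<bar> \<le> B\<^sup>2 * (1 - c2 / c1)"
      using FD n0 c by (simp add: abs_div field_simps power2_eq_square)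
    show "\<bar>D / (real n * c1 * c2)\<bar> \<le> B\<^sup>2"
      using Db n0 c by (simp add: abs_div field_simps)
    have "c2 \<le> c1" unfolding c1_def c2_def using m by (simp add: binomial_right_mono)
    thus "\<bar>1 - c2 / c1\<bar> \<le> 1 - c2 / c1" using c by (simp add: field_simps)
  qed auto
  finally show "\<bar>(\<Sum>a\<in>A. (jack_comp m n \<Phi> X a \<omega>)\<^sup>2) / real n - cross_avg \<omega>\<bar> \<le> 2 * B\<^sup>2 * (1 - p)"
    unfolding F D p_def c1_def[symmetric] c2_def[symmetric] by (simp add: algebra_simps)
qed

lemma jack_var_deviation:
  assumes \<omega>: "\<omega> \<in> space M"
  shows "\<bar>real n * jack_var m n \<Phi> X \<omega> - (real m)\<^sup>2 * zeta M d m \<Phi> X\<bar> \<le>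
    jack_bias m n B + (real m)\<^sup>2 * (\<bar>cross_avg \<omega> - \<gamma>\<bar> + 2 * B * \<bar>ustat m n \<Phi> X \<omega> - \<theta>\<bar>)"
proof -
  define U where "U = ustat m n \<Phi> X \<omega>"
  \<comment> \<open>This local \<open>Q\<close> is the mean of the squared jackknife components, not
    yet reduced to disjoint pairs; the overview's average is \<open>cross_avg\<close>.\<close>
  define Q where "Q = (\<Sum>a\<in>A. (jack_comp m n \<Phi> X a \<omega>)\<^sup>2) / real n"
  define \<rho> where "\<rho> = real n * (real n - 1) / (real n - real m)\<^sup>2"
  have n0: "real n > 0" "real n - real m > 0" using m n by auto
  have "(\<Sum>a\<in>A. (jack_comp m n \<Phi> X a \<omega> - U)\<^sup>2) =
      (\<Sum>a\<in>A. (jack_comp m n \<Phi> X a \<omega>)\<^sup>2) - 2 * U * (\<Sum>a\<in>A. jack_comp m n \<Phi> X a \<omega>) + real n * U\<^sup>2"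
    by (simp add: power2_diff sum.distrib sum_subtractf sum_distrib_left mult_ac)
  also have "\<dots> = real n * (Q - U\<^sup>2)"
    unfolding sum_jack_comp[OF \<omega>] U_def[symmetric] Q_def
    using n0 by (simp add: field_simps power2_eq_square)
  finally have "real n * jack_var m n \<Phi> X \<omega> = (real m)\<^sup>2 * (\<rho> * (Q - U\<^sup>2))"
    using n0 by (simp add: jack_var_def U_def[symmetric] \<rho>_def)
  \<comment> \<open>With \<zeta> = \<gamma> - \<theta>^2 the error splits into prefactor,
    overlapping pairs and random fluctuation; the first two make up
    \<open>jack_bias\<close>.\<close>
  hence "real n * jack_var m n \<Phi> X \<omega> - (real m)\<^sup>2 * zeta M d m \<Phi> X =
    (real m)\<^sup>2 * ((\<rho> - 1) * (Q - U\<^sup>2) + (Q - cross_avg \<omega>) + ((cross_avg \<omega> - \<gamma>) - (U\<^sup>2 - \<theta>\<^sup>2)))"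
    by (simp add: zeta_eq algebra_simps)
  also have "\<bar>\<dots>\<bar> = (real m)\<^sup>2 * \<bar>(\<rho> - 1) * (Q - U\<^sup>2) + (Q - cross_avg \<omega>) + ((cross_avg \<omega> - \<gamma>) - (U\<^sup>2 - \<theta>\<^sup>2))\<bar>"
    by (simp add: abs_mult)
  also have "\<dots> \<le> (real m)\<^sup>2 * (\<bar>\<rho> - 1\<bar> * (2 * B\<^sup>2) + 2 * B\<^sup>2 * (1 - p) + (\<bar>cross_avg \<omega> - \<gamma>\<bar> + 2 * B * \<bar>U - \<theta>\<bar>))"
  proof (intro mult_left_mono)
    have "U\<^sup>2 \<le> B\<^sup>2" using ustat_bound[OF \<omega>] B by (simp add: U_def abs_le_square_iff[symmetric])
    hence "\<bar>Q - U\<^sup>2\<bar> \<le> 2 * B\<^sup>2"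
      using jack_square_sum(2)[OF \<omega>] zero_le_power2[of U] unfolding Q_def[symmetric] by linarith
    hence 1: "\<bar>(\<rho> - 1) * (Q - U\<^sup>2)\<bar> \<le> \<bar>\<rho> - 1\<bar> * (2 * B\<^sup>2)"
      unfolding abs_mult by (intro mult_left_mono) auto
    have 2: "\<bar>Q - cross_avg \<omega>\<bar> \<le> 2 * B\<^sup>2 * (1 - p)"
      using jack_square_sum(1)[OF \<omega>] by (simp add: Q_def)
    have "\<bar>U + \<theta>\<bar> \<le> 2 * B"
      using ustat_bound[OF \<omega>] \<theta>_bound unfolding U_def[symmetric] by linarith
    hence "\<bar>U + \<theta>\<bar> * \<bar>U - \<theta>\<bar> \<le> 2 * B * \<bar>U - \<theta>\<bar>" by (intro mult_right_mono) auto
    moreover have "U\<^sup>2 - \<theta>\<^sup>2 = (U + \<theta>) * (U - \<theta>)" by (simp add: power2_eq_square algebra_simps)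
    ultimately have 3: "\<bar>U\<^sup>2 - \<theta>\<^sup>2\<bar> \<le> 2 * B * \<bar>U - \<theta>\<bar>" by (simp add: abs_mult)
    show "\<bar>(\<rho> - 1) * (Q - U\<^sup>2) + (Q - cross_avg \<omega>) + ((cross_avg \<omega> - \<gamma>) - (U\<^sup>2 - \<theta>\<^sup>2))\<bar> \<le>
      \<bar>\<rho> - 1\<bar> * (2 * B\<^sup>2) + 2 * B\<^sup>2 * (1 - p) + (\<bar>cross_avg \<omega> - \<gamma>\<bar> + 2 * B * \<bar>U - \<theta>\<bar>)"
      using 1 2 3 by linarith
  qed simp
  finally show ?thesis
    by (simp add: jack_bias_def \<rho>_def p_def U_def algebra_simps)
qed

lemma jack_var_concentration:
  assumes s: "s \<ge> 0"
  shows "prob {\<omega>\<in>space M. \<bar>real n * jack_var m n \<Phi> X \<omega> - (real m)\<^sup>2 * zeta M d m \<Phi> X\<bar> \<ge>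
      jack_bias m n B + (real m)\<^sup>2 * (1 + 2 * B) * s} \<le> 4 * exp (- (real K * s\<^sup>2 / (2 * B ^ 4)))"
proof -
  let ?E1 = "{\<omega>\<in>space M. \<bar>cross_avg \<omega> - \<gamma>\<bar> \<ge> s}"
  let ?E2 = "{\<omega>\<in>space M. \<bar>ustat m n \<Phi> X \<omega> - \<theta>\<bar> \<ge> s}"
  let ?E = "{\<omega>\<in>space M. \<bar>real n * jack_var m n \<Phi> X \<omega> - (real m)\<^sup>2 * zeta M d m \<Phi> X\<bar> \<ge>
      jack_bias m n B + (real m)\<^sup>2 * (1 + 2 * B) * s}"
  have "?E \<subseteq> ?E1 \<union> ?E2"
  proof (rule subsetI, rule ccontr)
    fix \<omega> assume \<omega>: "\<omega> \<in> ?E" "\<omega> \<notin> ?E1 \<union> ?E2"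
    hence lt: "\<bar>cross_avg \<omega> - \<gamma>\<bar> < s" "\<bar>ustat m n \<Phi> X \<omega> - \<theta>\<bar> < s" by auto
    have "\<bar>cross_avg \<omega> - \<gamma>\<bar> + 2 * B * \<bar>ustat m n \<Phi> X \<omega> - \<theta>\<bar> < s + 2 * B * s"
      using lt B by (intro add_less_le_mono mult_left_mono) auto
    hence "(real m)\<^sup>2 * (\<bar>cross_avg \<omega> - \<gamma>\<bar> + 2 * B * \<bar>ustat m n \<Phi> X \<omega> - \<theta>\<bar>) < (real m)\<^sup>2 * (s + 2 * B * s)"
      using m by (intro mult_strict_left_mono) auto
    with jack_var_deviation[of \<omega>] \<omega> show False by (auto simp: algebra_simps)
  qed
  hence "prob ?E \<le> prob (?E1 \<union> ?E2)" by (intro finite_measure_mono) auto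
  also have "\<dots> \<le> prob ?E1 + prob ?E2" by (rule measure_Un_le) auto
  also have "\<dots> \<le> 2 * exp (- (real K * s\<^sup>2 / (2 * (B\<^sup>2)\<^sup>2))) + 2 * exp (- (real K * s\<^sup>2 / (2 * B\<^sup>2)))"
    by (intro add_mono cross_avg_concentration ustat_concentration s)
  \<comment> \<open>The product kernel has bound \<open>B\<^sup>2\<close>, hence
    \<open>B ^ 4\<close> in its rate; as \<open>B \<ge> 1\<close>, the better rate of the
    U-statistic is weakened to match.\<close>
  also have "\<dots> \<le> 2 * exp (- (real K * s\<^sup>2 / (2 * B ^ 4))) + 2 * exp (- (real K * s\<^sup>2 / (2 * B ^ 4)))"
  proof (intro add_mono mult_left_mono)
    have "B\<^sup>2 \<le> B ^ 4" using B by (intro power_increasing) auto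
    thus "exp (- (real K * s\<^sup>2 / (2 * B\<^sup>2))) \<le> exp (- (real K * s\<^sup>2 / (2 * B ^ 4)))"
      using B by (auto intro!: divide_left_mono)
  qed (simp_all flip: power_mult)
  finally show ?thesis by simp
qed

text \<open>For fixed \<open>S\<close>, the fractions of m-sets disjoint from \<open>S\<close> and
  meeting it once are \<open>p0\<close> and \<open>p1\<close>. Their covariances with
  \<open>W S\<close> are 0 and \<zeta>; every other one is at most \<open>2 * B\<^sup>2\<close> in
  absolute value.\<close>

lemma variance_ustat_bound:
  defines "p0 \<equiv> real ((n - m) choose m) / real (n choose m)"
    and "p1 \<equiv> real m * real ((n - m) choose (m - 1)) / real (n choose m)"
  shows "\<bar>variance (ustat m n \<Phi> X) - zeta M d m \<Phi> X * p1\<bar> \<le> 2 * B\<^sup>2 * (1 - p0 - p1)"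
proof -
  define c where "c = real (n choose m)"
  have c: "c > 0" using m n by (simp add: c_def)
  define T where "T = subsets m A"
  have T: "finite T" "real (card T) = c" by (simp_all add: T_def c_def card_subsets)
  let ?U = "\<lambda>\<omega>. (\<Sum>S\<in>T. W S \<omega>) / c"
  have U: "ustat m n \<Phi> X \<omega> = ?U \<omega>" if "\<omega> \<in> space M" for \<omega>
    using ustat_eq[OF that] by (simp add: T_def c_def)
  define e where "e S R = expectation (\<lambda>\<omega>. W S \<omega> * W R \<omega>) - \<theta>\<^sup>2" for S R
  have intW: "integrable M (W S)" if "S \<in> T" for S using that by (simp add: T_def integrable_W)
  have intWW: "integrable M (\<lambda>\<omega>. W S \<omega> * W R \<omega>)" if "S \<in> T" "R \<in> T" for S R
    using that by (simp add: T_def integrable_W_mult)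
  have sq: "(?U \<omega>)\<^sup>2 = (\<Sum>S\<in>T. \<Sum>R\<in>T. W S \<omega> * W R \<omega>) / c\<^sup>2" for \<omega>
    by (simp only: power_divide power2_eq_square[of "sum _ _"] sum_product)
  have EU: "expectation ?U = \<theta>"
    using T c intW by (simp add: T_def expectation_W)
  have "variance (ustat m n \<Phi> X) = variance ?U"
    using U by (simp cong: Bochner_Integration.integral_cong)
  also have "\<dots> = expectation (\<lambda>\<omega>. (?U \<omega>)\<^sup>2) - (expectation ?U)\<^sup>2"
  proof (rule variance_eq)
    show "integrable M ?U"
      by (intro Bochner_Integration.integrable_divide Bochner_Integration.integrable_sum intW)
    show "integrable M (\<lambda>\<omega>. (?U \<omega>)\<^sup>2)" unfolding sq
      by (intro Bochner_Integration.integrable_divide Bochner_Integration.integrable_sum intWW)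
  qed
  also have "\<dots> = (\<Sum>S\<in>T. \<Sum>R\<in>T. e S R) / c\<^sup>2"
    unfolding EU sq using intWW c
    by (simp add: e_def sum_subtractf T field_simps power2_eq_square)
  finally have var: "variance (ustat m n \<Phi> X) = (\<Sum>S\<in>T. \<Sum>R\<in>T. e S R) / c\<^sup>2" .
  define z where "z = zeta M d m \<Phi> X"
  have inner: "\<bar>(\<Sum>R\<in>T. e S R) - z * (c * p1)\<bar> \<le> 2 * B\<^sup>2 * (c - c * p0 - c * p1)" if S: "S \<in> T" for S
  proof -
    let ?T0 = "{R \<in> T. S \<inter> R = {}}" and ?T1 = "{R \<in> T. card (S \<inter> R) = 1}"
    have SA: "S \<in> subsets m A" using S by (simp add: T_def)
    have card0: "real (card ?T0) = c * p0"
      using card_subsets_disjoint[OF _ SA] c by (simp add: T_def p0_def c_def)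
    have card1: "real (card ?T1) = c * p1"
      using card_subsets_meet_once[OF _ SA m] c by (simp add: T_def p1_def c_def)
    have disj: "?T0 \<inter> ?T1 = {}" by auto
    have "(\<Sum>R\<in>T. e S R) = (\<Sum>R\<in>?T0. e S R) + (\<Sum>R\<in>?T1. e S R) + (\<Sum>R\<in>T - (?T0 \<union> ?T1). e S R)"
    proof -
      have "(\<Sum>R\<in>T. e S R) = (\<Sum>R\<in>T - (?T0 \<union> ?T1). e S R) + (\<Sum>R\<in>?T0 \<union> ?T1. e S R)"
        using T by (intro sum.subset_diff) auto
      also have "(\<Sum>R\<in>?T0 \<union> ?T1. e S R) = (\<Sum>R\<in>?T0. e S R) + (\<Sum>R\<in>?T1. e S R)"
        using T disj by (intro sum.union_disjoint) auto
      finally show ?thesis by (simp only: ac_simps)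
    qed
    also have "(\<Sum>R\<in>?T0. e S R) = 0"
      using SA by (intro sum.neutral) (auto simp: e_def T_def expectation_W_mult_disjoint)
    also have "(\<Sum>R\<in>?T1. e S R) = (\<Sum>R\<in>?T1. z)"
      using SA by (intro sum.cong) (auto simp: e_def T_def expectation_W_mult_meet_once zeta_eq z_def)
    finally have "(\<Sum>R\<in>T. e S R) - z * (c * p1) = (\<Sum>R\<in>T - (?T0 \<union> ?T1). e S R)"
      by (simp add: card1[symmetric])
    also have "\<bar>\<dots>\<bar> \<le> (\<Sum>R\<in>T - (?T0 \<union> ?T1). 2 * B\<^sup>2)"
    proof (intro order_trans[OF sum_abs] sum_mono)
      fix R assume "R \<in> T - (?T0 \<union> ?T1)"
      hence R: "R \<in> subsets m A" "R \<in> T" by (simp_all add: T_def)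
      have "\<bar>expectation (\<lambda>\<omega>. W S \<omega> * W R \<omega>)\<bar> \<le> expectation (\<lambda>\<omega>. \<bar>W S \<omega> * W R \<omega>\<bar>)"
        by (rule integral_abs_bound)
      also have "\<dots> \<le> expectation (\<lambda>\<omega>. B\<^sup>2)"
        using W_mult_bound[OF SA R(1)] intWW[OF S R(2)] by (intro integral_mono) auto
      finally have "\<bar>expectation (\<lambda>\<omega>. W S \<omega> * W R \<omega>)\<bar> \<le> B\<^sup>2" by (simp add: prob_space)
      moreover have "\<theta>\<^sup>2 \<le> B\<^sup>2" using \<theta>_bound B by (simp add: abs_le_square_iff[symmetric])
      ultimately show "\<bar>e S R\<bar> \<le> 2 * B\<^sup>2"
        using zero_le_power2[of \<theta>] unfolding e_def by linarith
    qed
    also have "\<dots> = real (card (T - (?T0 \<union> ?T1))) * (2 * B\<^sup>2)" by simp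
    also have "real (card (T - (?T0 \<union> ?T1))) = c - c * p0 - c * p1"
    proof -
      have "card (?T0 \<union> ?T1) = card ?T0 + card ?T1"
        using T disj by (intro card_Un_disjoint) auto
      moreover have "card (T - (?T0 \<union> ?T1)) = card T - card (?T0 \<union> ?T1)"
        using T by (intro card_Diff_subset) auto
      moreover have "card (?T0 \<union> ?T1) \<le> card T"
        using T by (intro card_mono) auto
      ultimately show ?thesis by (simp only: of_nat_diff of_nat_add T card0 card1)
    qed
    finally show ?thesis by (simp add: mult_ac)
  qed
  have "variance (ustat m n \<Phi> X) - z * p1 = (\<Sum>S\<in>T. (\<Sum>R\<in>T. e S R) - z * (c * p1)) / c\<^sup>2"
    unfolding var sum_subtractf using c by (simp add: T field_simps power2_eq_square)
  also have "\<bar>\<dots>\<bar> \<le> (\<Sum>S\<in>T. 2 * B\<^sup>2 * (c - c * p0 - c * p1)) / c\<^sup>2"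
    unfolding abs_divide using inner
    by (simp only: abs_power2) (intro divide_right_mono order_trans[OF sum_abs] sum_mono, auto)
  also have "\<dots> = 2 * B\<^sup>2 * (1 - p0 - p1)"
    using c by (simp add: T field_simps power2_eq_square)
  finally show ?thesis by (simp only: z_def)
qed

end

section \<open>Asymptotics\<close>

text \<open>A random s-subset of n points hits a fixed a-subset with probability about a s / n.
  Writing r(s) for the ratio, the induction rests on r(s + 1) = r(s) (1 - a / (n - s)).\<close>

lemma choose_ratio_asymp:
  "(\<lambda>n. real n * (1 - real ((n - a) choose s) / real (n choose s))) \<longlonglongrightarrow> real a * real s"
proof (induction s)
  case 0
  show ?case by simp
next
  case (Suc s)
  let ?r = "\<lambda>s n. real ((n - a) choose s) / real (n choose s)"
  \<comment> \<open>Dividing the induction hypothesis by n gives convergence of the ratio itself to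
    1, which controls the correction term.\<close>
  have "(\<lambda>n. (real n * (1 - ?r s n)) * (1 / real n)) \<longlonglongrightarrow> real a * real s * 0"
    by (intro tendsto_mult Suc.IH) real_asymp
  hence "(\<lambda>n. 1 - (real n * (1 - ?r s n)) * (1 / real n)) \<longlonglongrightarrow> 1 - 0"
    by (intro tendsto_diff) simp_all
  moreover have "\<forall>\<^sub>F n in sequentially. 1 - (real n * (1 - ?r s n)) * (1 / real n) = ?r s n"
    using eventually_gt_at_top[of 0] by eventually_elim simp
  ultimately have r: "?r s \<longlonglongrightarrow> 1" by (simp add: tendsto_cong)
  have "(\<lambda>n. real a * (real n / (real n - real s))) \<longlonglongrightarrow> real a * 1"
    by (intro tendsto_mult tendsto_const) real_asymp
  from this have "(\<lambda>n. real n * (1 - ?r s n) + ?r s n * (real a * (real n / (real n - real s)))) \<longlonglongrightarrow>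
      real a * real s + 1 * (real a * 1)"
    by (intro tendsto_add[OF Suc.IH tendsto_mult[OF r]])
  moreover have "\<forall>\<^sub>F n in sequentially.
      real n * (1 - ?r s n) + ?r s n * (real a * (real n / (real n - real s))) = real n * (1 - ?r (Suc s) n)"
    using eventually_ge_at_top[of "a + Suc s"]
  proof eventually_elim
    case (elim n)
    have rec: "real (N choose Suc s) = real (N choose s) * (real N - real s) / (real s + 1)" if "s \<le> N" for N
    proof -
      have "Suc s * (N choose Suc s) = (N - s) * (N choose s)"
        by (metis binomial_absorb_comp binomial_absorption)
      hence "real (Suc s) * real (N choose Suc s) = real (N - s) * real (N choose s)"
        by (simp only: of_nat_mult[symmetric])
      thus ?thesis using that by (simp add: field_simps of_nat_diff)
    qed
    have pos: "real (n choose s) > 0" "real n - real s > 0" using elim by auto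
    have "?r (Suc s) n = ?r s n * ((real n - real a - real s) / (real n - real s))"
      using rec[of n] rec[of "n - a"] elim by (simp add: of_nat_diff)
    also have "\<dots> = ?r s n - ?r s n * (real a / (real n - real s))"
      using pos(2) by (simp add: field_simps)
    finally have q: "?r (Suc s) n = ?r s n - ?r s n * (real a / (real n - real s))" .
    show ?case unfolding q by (simp add: algebra_simps)
  qed
  ultimately have "(\<lambda>n. real n * (1 - ?r (Suc s) n)) \<longlonglongrightarrow> real a * real s + 1 * (real a * 1)"
    by (rule Lim_transform_eventually)
  thus ?case by (simp add: algebra_simps)
qed

text \<open>At \<open>Suc n\<close> the ratio has the form of \<open>choose_ratio_asymp\<close> with
  both parameters \<open>m - 1\<close>; the index shift changes the factor n by a ratio tending to
  1.\<close>

lemma choose_pred_ratio_asymp: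
  assumes m: "m \<ge> 1"
  defines "p \<equiv> \<lambda>n. real ((n - m) choose (m - 1)) / real ((n - 1) choose (m - 1))"
  shows "(\<lambda>n. real n * (1 - p n)) \<longlonglongrightarrow> (real m - 1)\<^sup>2" and "p \<longlonglongrightarrow> 1"
proof -
  have "p (Suc n) = real ((n - (m - 1)) choose (m - 1)) / real (n choose (m - 1))" for n
    using m by (cases m) (simp_all add: p_def)
  hence *: "(\<lambda>n. real n * (1 - p (Suc n))) \<longlonglongrightarrow> real (m - 1) * real (m - 1)"
    using choose_ratio_asymp[of "m - 1" "m - 1"] by (simp only:)
  have "(\<lambda>n. real (Suc n) / real n) \<longlonglongrightarrow> 1" by real_asymp
  from tendsto_mult[OF this *] have "(\<lambda>n. real (Suc n) / real n * (real n * (1 - p (Suc n)))) \<longlonglongrightarrow> 1 * (real (m - 1) * real (m - 1))" .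
  moreover have "\<forall>\<^sub>F n in sequentially. real (Suc n) / real n * (real n * (1 - p (Suc n))) = real (Suc n) * (1 - p (Suc n))"
    using eventually_gt_at_top[of 0] by eventually_elim simp
  ultimately have "(\<lambda>n. real (Suc n) * (1 - p (Suc n))) \<longlonglongrightarrow> 1 * (real (m - 1) * real (m - 1))"
    by (rule Lim_transform_eventually)
  hence lim: "(\<lambda>n. real n * (1 - p n)) \<longlonglongrightarrow> real (m - 1) * real (m - 1)"
    by (subst (asm) filterlim_sequentially_Suc) simp
  thus "(\<lambda>n. real n * (1 - p n)) \<longlonglongrightarrow> (real m - 1)\<^sup>2"
    using m by (simp add: of_nat_diff power2_eq_square)
  have "(\<lambda>n. (real n * (1 - p n)) * (1 / real n)) \<longlonglongrightarrow> real (m - 1) * real (m - 1) * 0"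
    by (intro tendsto_mult lim) real_asymp
  hence "(\<lambda>n. 1 - (real n * (1 - p n)) * (1 / real n)) \<longlonglongrightarrow> 1 - 0"
    by (intro tendsto_diff) simp_all
  moreover have "\<forall>\<^sub>F n in sequentially. 1 - (real n * (1 - p n)) * (1 / real n) = p n"
    using eventually_gt_at_top[of 0] by eventually_elim simp
  ultimately show "p \<longlonglongrightarrow> 1" by (simp add: tendsto_cong)
qed

lemma jack_bias_le:
  assumes m: "m \<ge> 1"
  obtains C where "C > 0" "\<forall>\<^sub>F n in sequentially. jack_bias m n B \<le> C / real n"
proof -
  have rho: "(\<lambda>n. real n * (real n * (real n - 1) / (real n - c)\<^sup>2 - 1)) \<longlonglongrightarrow> 2 * c - 1" for c :: real
  proof -
    \<comment> \<open>Over the common denominator (n - c)^2 the quadratic terms of the numerator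
      cancel, leaving (2c - 1) n - c^2, so multiplication by n yields a finite limit.\<close>
    have "(\<lambda>n. ((2 * c - 1) - c\<^sup>2 / real n) * (real n / (real n - c))\<^sup>2) \<longlonglongrightarrow> ((2 * c - 1) - 0) * 1\<^sup>2"
      by (intro tendsto_mult tendsto_diff tendsto_power tendsto_const) real_asymp+
    moreover have "\<forall>\<^sub>F n in sequentially. ((2 * c - 1) - c\<^sup>2 / real n) * (real n / (real n - c))\<^sup>2 =
        real n * (real n * (real n - 1) / (real n - c)\<^sup>2 - 1)"
      using eventually_gt_at_top[of "nat \<lceil>\<bar>c\<bar>\<rceil>"]
    proof eventually_elim
      case (elim n)
      have *: "((2 * c - 1) - c\<^sup>2 / x) * (x / y)\<^sup>2 = x * (x * (x - 1) / y\<^sup>2 - 1)"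
        if "x \<noteq> 0" "y \<noteq> 0" "c = x - y" for x y
        unfolding that(3) using that(1,2) by (simp add: field_simps power2_eq_square)
      show ?case by (rule *) (use elim in linarith)+
    qed
    ultimately show ?thesis by (auto dest: Lim_transform_eventually)
  qed
  let ?p = "\<lambda>n. real ((n - m) choose (m - 1)) / real ((n - 1) choose (m - 1))"
  have "(\<lambda>n. (real m)\<^sup>2 * (2 * B\<^sup>2) * (\<bar>real n * (real n * (real n - 1) / (real n - real m)\<^sup>2 - 1)\<bar> +
      real n * (1 - ?p n))) \<longlonglongrightarrow> (real m)\<^sup>2 * (2 * B\<^sup>2) * (\<bar>2 * real m - 1\<bar> + (real m - 1)\<^sup>2)"
    (is "?f \<longlonglongrightarrow> ?l") by (intro tendsto_intros rho choose_pred_ratio_asymp m)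
  hence "\<forall>\<^sub>F n in sequentially. ?f n < \<bar>?l\<bar> + 1"
    by (rule order_tendstoD) linarith
  hence "\<forall>\<^sub>F n in sequentially. jack_bias m n B \<le> (\<bar>?l\<bar> + 1) / real n"
    using eventually_gt_at_top[of 0]
  proof eventually_elim
    case (elim n)
    have "real n * jack_bias m n B = ?f n"
      by (simp only: jack_bias_def abs_mult abs_of_nat distrib_left mult_ac)
    thus ?case using elim by (simp add: field_simps)
  qed
  moreover have "\<bar>?l\<bar> + 1 > 0" by linarith
  ultimately show ?thesis using that by blast
qed

section \<open>Limits for a fixed law and uniform convergence along a sequence\<close>

lemma iid_kernelI:
  assumes "prob_space M" "kernel_family d m q B \<Phi>" "i \<in> {1..q}" "j \<in> {1..q}"
    "iid_copies M d P I X" "{1..n} \<subseteq> I" "m \<ge> 1" "2 * m \<le> n"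
  shows "iid_kernel M d m n (max 1 B) P X (\<Phi> i j)"
proof -
  interpret prob_space M by fact
  show ?thesis
  proof
    show "iid_copies M d P {1..n} X"
      using assms(5,6) indep_vars_subset unfolding iid_copies_def by blast
    show "symmetric_kernel d m (\<Phi> i j)"
      using assms(2-4) by (simp add: kernel_family_def)
    show "\<bar>\<Phi> i j x\<bar> \<le> max 1 B" if "x \<in> space (Rdm d m)" for x
      using assms(2-4) that unfolding kernel_family_def by (meson max.coboundedI2)
  qed (use assms in auto)
qed

text \<open>Both n (1 - p0) and n p1 tend to m^2. Their difference bounds the pairs with larger
  overlap and vanishes, while n p1 \<zeta> gives the limit.\<close>

lemma variance_ustat_tendsto:
  assumes m: "m \<ge> 1" and ik: "\<And>n. 2 * m \<le> n \<Longrightarrow> iid_kernel M d m n B P X \<Phi>"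
  shows "(\<lambda>n. real n * prob_space.variance M (ustat m n \<Phi> X)) \<longlonglongrightarrow> (real m)\<^sup>2 * zeta M d m \<Phi> X"
proof -
  define z where "z = zeta M d m \<Phi> X"
  define p0 where "p0 n = real ((n - m) choose m) / real (n choose m)" for n
  define p1 where "p1 n = real m * real ((n - m) choose (m - 1)) / real (n choose m)" for n
  define p where "p n = real ((n - m) choose (m - 1)) / real ((n - 1) choose (m - 1))" for n
  have np1: "real n * p1 n = (real m)\<^sup>2 * p n" if "n \<ge> m" for n
  proof -
    have "m * (n choose m) = n * ((n - 1) choose (m - 1))"
      using times_binomial_minus1_eq[of m n] m by simp
    hence "real m * real (n choose m) = real n * real ((n - 1) choose (m - 1))"
      by (simp flip: of_nat_mult)
    moreover have "n choose m > 0" "(n - 1) choose (m - 1) > 0" using m that by auto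
    ultimately show ?thesis by (simp add: p1_def p_def field_simps power2_eq_square)
  qed
  have "p \<longlonglongrightarrow> 1" unfolding p_def by (rule choose_pred_ratio_asymp[OF m])
  hence "(\<lambda>n. (real m)\<^sup>2 * p n) \<longlonglongrightarrow> (real m)\<^sup>2 * 1" by (intro tendsto_intros)
  moreover have "\<forall>\<^sub>F n in sequentially. (real m)\<^sup>2 * p n = real n * p1 n"
    using eventually_ge_at_top[of m] by eventually_elim (simp add: np1)
  ultimately have l1: "(\<lambda>n. real n * p1 n) \<longlonglongrightarrow> (real m)\<^sup>2 * 1"
    by (rule Lim_transform_eventually)
  have l0: "(\<lambda>n. real n * (1 - p0 n)) \<longlonglongrightarrow> real m * real m"
    unfolding p0_def by (rule choose_ratio_asymp)
  have err: "(\<lambda>n. 2 * B\<^sup>2 * (real n * (1 - p0 n) - real n * p1 n)) \<longlonglongrightarrow> 2 * B\<^sup>2 * (real m * real m - (real m)\<^sup>2 * 1)"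
    by (intro tendsto_mult tendsto_diff tendsto_const l0 l1)
  have "(\<lambda>n. real n * prob_space.variance M (ustat m n \<Phi> X) - z * (real n * p1 n)) \<longlonglongrightarrow> 0"
  proof (rule Lim_null_comparison)
    show "(\<lambda>n. 2 * B\<^sup>2 * (real n * (1 - p0 n) - real n * p1 n)) \<longlonglongrightarrow> 0"
      using err by (simp add: power2_eq_square)
    show "\<forall>\<^sub>F n in sequentially. norm (real n * prob_space.variance M (ustat m n \<Phi> X) - z * (real n * p1 n)) \<le>
        2 * B\<^sup>2 * (real n * (1 - p0 n) - real n * p1 n)"
      using eventually_ge_at_top[of "2 * m"]
    proof eventually_elim
      case (elim n)
      let ?v = "prob_space.variance M (ustat m n \<Phi> X)"
      interpret iid_kernel M d m n B P X \<Phi> by (rule ik[OF elim])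
      have "\<bar>?v - z * p1 n\<bar> \<le> 2 * B\<^sup>2 * (1 - p0 n - p1 n)"
        unfolding p0_def p1_def z_def by (rule variance_ustat_bound)
      hence "real n * \<bar>?v - z * p1 n\<bar> \<le> real n * (2 * B\<^sup>2 * (1 - p0 n - p1 n))"
        by (rule mult_left_mono) simp
      moreover have "real n * ?v - z * (real n * p1 n) = real n * (?v - z * p1 n)"
        by (simp add: algebra_simps)
      ultimately show ?case
        by (simp only: real_norm_def abs_mult abs_of_nat) (simp add: algebra_simps)
    qed
  qed
  from tendsto_add[OF this tendsto_mult[OF tendsto_const[of z] l1]]
  show ?thesis by (simp add: z_def mult.commute)
qed

lemma jack_var_tail:
  assumes m: "m \<ge> 1" and ik: "iid_kernel M d m n B P X \<Phi>" and n4: "4 * m \<le> n"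
    and \<tau>: "\<tau> \<ge> 0" "jack_bias m n B \<le> \<tau> / 2"
  shows "measure M {\<omega>\<in>space M. \<bar>real n * jack_var m n \<Phi> X \<omega> - (real m)\<^sup>2 * zeta M d m \<Phi> X\<bar> \<ge> \<tau>}
    \<le> 4 * exp (- (real n * \<tau>\<^sup>2 / (32 * real m ^ 5 * (1 + 2 * B)\<^sup>2 * B ^ 4)))"
proof -
  interpret iid_kernel M d m n B P X \<Phi> by (rule ik)
  \<comment> \<open>Half of \<tau> is reserved for the bias, and \<open>s\<close> makes the
    fluctuation threshold equal to the other half. Its square contributes 4 m^4 (1 + 2B)^2 to the
    constant; K \<ge> n / (4m) and the denominator 2 B^4 supply the remaining factors.\<close>
  define s where "s = \<tau> / (2 * (real m)\<^sup>2 * (1 + 2 * B))"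
  have pos: "real m > 0" "1 + 2 * B > 0" "B > 0" using m B by auto
  have s: "s \<ge> 0" using \<tau> pos by (simp add: s_def)
  have "(real m)\<^sup>2 * w * (\<tau> / (2 * (real m)\<^sup>2 * w)) = \<tau> / 2" if "w > 0" for w
    using that pos by (simp add: field_simps)
  from this[OF pos(2)] have ms: "(real m)\<^sup>2 * (1 + 2 * B) * s = \<tau> / 2" unfolding s_def .
  \<comment> \<open>The remainder of the division is below 2m, hence at most half of n since
    \<open>4 * m \<le> n\<close>.\<close>
  have "real n / real (4 * m) \<le> real K"
  proof -
    have "n = K * (2 * m - 1) + n mod (2 * m - 1)" by (rule div_mult_mod_eq[symmetric])
    also have "\<dots> \<le> K * (2 * m) + 2 * m"
      using m by (intro add_mono mult_le_mono2) (auto intro!: less_imp_le order.strict_trans2[OF mod_less_divisor])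
    finally have "n \<le> K * (2 * m) + 2 * m" .
    hence "2 * n \<le> K * (4 * m) + n" using n4 by linarith
    hence "n \<le> K * (4 * m)" by linarith
    hence "real n \<le> real K * real (4 * m)" unfolding of_nat_mult[symmetric] of_nat_le_iff .
    thus ?thesis using m by (simp add: field_simps)
  qed
  hence "real n / real (4 * m) * s\<^sup>2 / (2 * B ^ 4) \<le> real K * s\<^sup>2 / (2 * B ^ 4)"
    using pos by (intro divide_right_mono mult_right_mono) auto
  moreover have "real n / real (4 * m) * s\<^sup>2 / (2 * B ^ 4) = real n * \<tau>\<^sup>2 / (32 * real m ^ 5 * (1 + 2 * B)\<^sup>2 * B ^ 4)"
    by (simp add: s_def power_divide power_mult_distrib) (simp add: power_def mult_ac)
  ultimately have exp: "exp (- (real K * s\<^sup>2 / (2 * B ^ 4))) \<le>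
      exp (- (real n * \<tau>\<^sup>2 / (32 * real m ^ 5 * (1 + 2 * B)\<^sup>2 * B ^ 4)))" by simp
  have "prob {\<omega>\<in>space M. \<bar>real n * jack_var m n \<Phi> X \<omega> - (real m)\<^sup>2 * zeta M d m \<Phi> X\<bar> \<ge> \<tau>} \<le>
    prob {\<omega>\<in>space M. \<bar>real n * jack_var m n \<Phi> X \<omega> - (real m)\<^sup>2 * zeta M d m \<Phi> X\<bar> \<ge>
      jack_bias m n B + (real m)\<^sup>2 * (1 + 2 * B) * s}"
    using \<tau>(2) unfolding ms by (intro finite_measure_mono) auto
  also have "\<dots> \<le> 4 * exp (- (real K * s\<^sup>2 / (2 * B ^ 4)))"
    by (rule jack_var_concentration[OF s])
  finally show ?thesis using exp by linarith
qed

lemma jack_var_tendsto_in_prob: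
  assumes m: "m \<ge> 1" and ik: "\<And>n. 2 * m \<le> n \<Longrightarrow> iid_kernel M d m n B P X \<Phi>"
  shows "tendsto_in_prob M (\<lambda>n \<omega>. real n * jack_var m n \<Phi> X \<omega>) ((real m)\<^sup>2 * zeta M d m \<Phi> X)"
  unfolding tendsto_in_prob_def
proof (intro allI impI)
  fix \<delta> :: real assume \<delta>: "\<delta> > 0"
  have B: "B \<ge> 1" using iid_kernel.B[OF ik[OF order_refl]] .
  define D where "D = \<delta>\<^sup>2 / (32 * real m ^ 5 * (1 + 2 * B)\<^sup>2 * B ^ 4)"
  have D: "D > 0" using \<delta> m B by (simp add: D_def)
  obtain C where C: "C > 0" "\<forall>\<^sub>F n in sequentially. jack_bias m n B \<le> C / real n"
    using jack_bias_le[OF m] .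
  have "(\<lambda>n. C / real n) \<longlonglongrightarrow> 0" by real_asymp
  hence small: "\<forall>\<^sub>F n in sequentially. C / real n < \<delta> / 2"
    by (rule order_tendstoD) (use \<delta> in simp)
  show "(\<lambda>n. measure M {\<omega> \<in> space M. \<delta> \<le> \<bar>real n * jack_var m n \<Phi> X \<omega> - (real m)\<^sup>2 * zeta M d m \<Phi> X\<bar>}) \<longlonglongrightarrow> 0"
  proof (rule tendsto_sandwich[OF _ _ tendsto_const])
    show "(\<lambda>n. 4 * exp (- (real n * D))) \<longlonglongrightarrow> 0" using D by real_asymp
    show "\<forall>\<^sub>F n in sequentially. measure M {\<omega> \<in> space M. \<delta> \<le> \<bar>real n * jack_var m n \<Phi> X \<omega> - (real m)\<^sup>2 * zeta M d m \<Phi> X\<bar>}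
       \<le> 4 * exp (- (real n * D))"
      using C(2) small eventually_ge_at_top[of "4 * m"]
    proof eventually_elim
      case (elim n)
      have "iid_kernel M d m n B P X \<Phi>" using elim by (intro ik) simp
      from jack_var_tail[OF m this elim(3), of \<delta>] \<delta> elim show ?case by (simp add: D_def)
    qed
  qed simp
qed

lemma jack_var_uniform:
  fixes Ms :: "nat \<Rightarrow> 'w measure" and \<epsilon> :: real
  assumes m: "m \<ge> 1"
    and Ms: "\<And>k. prob_space (Ms k)"
    and kf: "\<And>k. kernel_family (ds k) m (qs k) B (\<Phi>s k)"
    and iid: "\<And>k. iid_copies (Ms k) (ds k) (Ps k) {1..ns k} (Xs k)"
    and N: "filterlim N at_top sequentially" and qs: "filterlim qs at_top sequentially"
    and ns: "(\<lambda>k. real (ns k)) \<in> \<Theta>(\<lambda>k. real (N k))"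
    and \<epsilon>: "\<epsilon> > 0"
    and lnq: "(\<lambda>k. ln (real (qs k))) \<in> O(\<lambda>k. real (N k) powr (1/3 - \<epsilon>))"
  shows "(\<lambda>k. measure (Ms k) {\<omega> \<in> space (Ms k).
      (MAX (i, j)\<in>{1..qs k} \<times> {1..qs k}.
         \<bar>real (ns k) * jack_var m (ns k) (\<Phi>s k i j) (Xs k) \<omega>
          - (real m)\<^sup>2 * zeta (Ms k) (ds k) m (\<Phi>s k i j) (Xs k)\<bar>)
      \<ge> real (N k) powr (- \<epsilon>) / ln (real (qs k))}) \<longlonglongrightarrow> 0"
proof -
  define B1 where "B1 = max 1 B"
  have B1: "B1 \<ge> 1" by (simp add: B1_def)
  define D0 where "D0 = 32 * real m ^ 5 * (1 + 2 * B1)\<^sup>2 * B1 ^ 4"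
  have D0: "D0 > 0" using m B1 by (simp add: D0_def)
  define \<tau> where "\<tau> k = real (N k) powr (- \<epsilon>) / ln (real (qs k))" for k
  obtain C where C: "C > 0" "\<forall>\<^sub>F n in sequentially. jack_bias m n B1 \<le> C / real n"
    using jack_bias_le[OF m] .
  \<comment> \<open>The lower half of the order relation bounds each sample size below by a multiple
    of \<open>N k\<close>, so rates can be stated in \<open>N k\<close>.\<close>
  have "(\<lambda>k. real (N k)) \<in> O(\<lambda>k. real (ns k))"
    using ns by (simp add: bigtheta_def bigomega_iff_bigo)
  then obtain c' where c': "c' > 0" "\<forall>\<^sub>F k in sequentially. norm (real (N k)) \<le> c' * norm (real (ns k))"
    by (elim landau_o.bigE)
  define c where "c = 1 / c'"
  have c: "c > 0" "\<forall>\<^sub>F k in sequentially. c * real (N k) \<le> real (ns k)"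
    using c' by (auto simp: c_def field_simps elim!: eventually_mono)
  obtain A where A: "A > 0" "\<forall>\<^sub>F k in sequentially. norm (ln (real (qs k))) \<le> A * norm (real (N k) powr (1/3 - \<epsilon>))"
    using lnq by (elim landau_o.bigE)
  have Nreal: "filterlim (\<lambda>k. real (N k)) at_top sequentially"
    by (rule filterlim_compose[OF filterlim_real_sequentially N])
  have "filterlim (\<lambda>k. c * real (N k)) at_top sequentially"
    using c Nreal by (intro filterlim_tendsto_pos_mult_at_top[OF tendsto_const])
  hence "filterlim (\<lambda>k. real (ns k)) at_top sequentially"
    by (rule filterlim_at_top_mono) (rule c)
  hence nstop: "filterlim ns at_top sequentially"
    by (simp add: filterlim_sequentially_iff_filterlim_real)
  have ev_powr: "\<forall>\<^sub>F k in sequentially. a \<le> real (N k) powr b" if "b > 0" for a b :: real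
  proof -
    have "filterlim (\<lambda>x :: real. x powr b) at_top at_top" using that by real_asymp
    from filterlim_compose[OF this Nreal] show ?thesis by (simp add: filterlim_at_top)
  qed
  have two_thirds: "(2/3 :: real) > 0" by simp
  \<comment> \<open>The last two eventual conditions are the ones that \<open>bias\<close> and
    \<open>expo\<close> need for N powr (2/3) and N powr \<epsilon>; at least 3 kernel indices
    ensure a positive logarithm and a maximum over a nonempty set.\<close>
  have bound: "\<forall>\<^sub>F k in sequentially. measure (Ms k) {\<omega> \<in> space (Ms k).
      (MAX (i, j)\<in>{1..qs k} \<times> {1..qs k}.
         \<bar>real (ns k) * jack_var m (ns k) (\<Phi>s k i j) (Xs k) \<omega>
          - (real m)\<^sup>2 * zeta (Ms k) (ds k) m (\<Phi>s k i j) (Xs k)\<bar>) \<ge> \<tau> k} \<le> 4 / real (qs k)"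
    using c(2) A(2) filterlim_at_top[THEN iffD1, OF nstop, rule_format, of "4 * m"]
      eventually_compose_filterlim[OF C(2) nstop]
      filterlim_at_top[THEN iffD1, OF qs, rule_format, of 3]
      filterlim_at_top[THEN iffD1, OF N, rule_format, of 1]
      ev_powr[OF two_thirds, of "2 * C * A / c"] ev_powr[OF \<epsilon>, of "3 * A ^ 3 * D0 / c"]
  proof eventually_elim
    case (elim k)
    define x where "x = real (N k)"
    define L where "L = ln (real (qs k))"
    have x: "x \<ge> 1" using elim(6) by (simp add: x_def)
    have "real (qs k) \<ge> 3" using elim(5) by simp
    hence L: "L > 0" by (simp add: L_def)
    have LA: "L \<le> A * x powr (1/3 - \<epsilon>)" using elim(2) by (simp add: L_def x_def)
    have \<tau>: "\<tau> k = x powr (- \<epsilon>) / L" by (simp add: \<tau>_def x_def L_def)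
    have \<tau>0: "\<tau> k \<ge> 0" using L by (simp add: \<tau>)
    have nx: "c * x \<le> real (ns k)" using elim(1) by (simp add: x_def)
    have cx: "c * x > 0" using c x by simp
    \<comment> \<open>The bias is of order 1/N, so the claim reduces to 2 C L \<le> c N powr (1 -
      \<epsilon>). The bound on \<open>L\<close> leaves a spare factor N powr (2/3).\<close>
    have bias: "jack_bias m (ns k) B1 \<le> \<tau> k / 2"
    proof -
      have "2 * C * L \<le> 2 * C * (A * x powr (1/3 - \<epsilon>))"
        using C LA by (intro mult_left_mono) auto
      also have "\<dots> = c * x powr (1/3 - \<epsilon>) * (2 * C * A / c)" using c by simp
      also have "\<dots> \<le> c * x powr (1/3 - \<epsilon>) * x powr (2/3)"
        using elim(7) c by (intro mult_left_mono) (auto simp: x_def)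
      also have "\<dots> = c * (x * x powr (- \<epsilon>))"
      proof -
        have "x powr (1/3 - \<epsilon>) * x powr (2/3) = x powr (1 + - \<epsilon>)"
          unfolding powr_add[symmetric] by (rule arg_cong[where f = "(powr) x"]) simp
        also have "\<dots> = x * x powr (- \<epsilon>)" unfolding powr_add using x by simp
        finally show ?thesis by (simp only: mult.assoc)
      qed
      finally have "C / (c * x) \<le> \<tau> k / 2"
        using cx L unfolding \<tau> by (simp add: field_simps)
      moreover have "C / real (ns k) \<le> C / (c * x)"
        by (rule frac_le[OF less_imp_le[OF C(1)] order_refl cx nx])
      ultimately show ?thesis using elim(4) by linarith
    qed
    \<comment> \<open>Each tail becomes 4 exp (-3 L) = 4 / q^3, so the union over q^2 index pairs
      still leaves 4 / q. The inequality is the cube of the bound on \<open>L\<close>, with N powr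
      \<epsilon> absorbing the constants.\<close>
    have expo: "3 * L \<le> real (ns k) * (\<tau> k)\<^sup>2 / D0"
    proof -
      have "3 * L * (L\<^sup>2 * D0) = 3 * D0 * L ^ 3" by (simp add: power2_eq_square power3_eq_cube)
      also have "\<dots> \<le> 3 * D0 * (A * x powr (1/3 - \<epsilon>)) ^ 3"
        using L LA D0 by (intro mult_left_mono power_mono) auto
      also have "\<dots> = c * (3 * A ^ 3 * D0 / c) * (x powr (1/3 - \<epsilon>)) ^ 3"
        using c by (simp add: power_mult_distrib)
      also have "\<dots> \<le> c * x powr \<epsilon> * (x powr (1/3 - \<epsilon>)) ^ 3"
        using elim(8) c by (intro mult_right_mono mult_left_mono) (auto simp: x_def)
      also have "\<dots> = c * (x * (x powr (- \<epsilon>))\<^sup>2)"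
      proof -
        have "x powr \<epsilon> * (x powr (1/3 - \<epsilon>)) ^ 3 = x powr (\<epsilon> + (1/3 - \<epsilon>) + (1/3 - \<epsilon>) + (1/3 - \<epsilon>))"
          unfolding powr_add by (simp add: power3_eq_cube)
        also have "\<epsilon> + (1/3 - \<epsilon>) + (1/3 - \<epsilon>) + (1/3 - \<epsilon>) = 1 + - \<epsilon> + - \<epsilon>" by simp
        also have "x powr \<dots> = x * (x powr (- \<epsilon>))\<^sup>2"
          unfolding powr_add using x by (simp add: power2_eq_square)
        finally show ?thesis by (simp only: mult.assoc)
      qed
      finally have "3 * L \<le> c * x * (\<tau> k)\<^sup>2 / D0"
        using L D0 unfolding \<tau> by (simp add: field_simps)
      also have "\<dots> \<le> real (ns k) * (\<tau> k)\<^sup>2 / D0"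
        using nx D0 by (intro divide_right_mono mult_right_mono) auto
      finally show ?thesis .
    qed
    interpret prob_space "Ms k" by (rule Ms)
    let ?I = "{1..qs k} \<times> {1..qs k}"
    let ?f = "\<lambda>\<omega> (i, j). \<bar>real (ns k) * jack_var m (ns k) (\<Phi>s k i j) (Xs k) \<omega>
          - (real m)\<^sup>2 * zeta (Ms k) (ds k) m (\<Phi>s k i j) (Xs k)\<bar>"
    let ?E = "\<lambda>ij. {\<omega> \<in> space (Ms k). ?f \<omega> ij \<ge> \<tau> k}"
    have ik: "iid_kernel (Ms k) (ds k) m (ns k) B1 (Ps k) (Xs k) (\<Phi>s k i j)" if "(i, j) \<in> ?I" for i j
      unfolding B1_def using that elim(3) by (intro iid_kernelI[OF Ms kf _ _ iid _ m]) auto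
    have meas: "?E ij \<in> sets (Ms k)" if "ij \<in> ?I" for ij
    proof -
      obtain i j where ij: "ij = (i, j)" by (cases ij)
      interpret iid_kernel "Ms k" "ds k" m "ns k" B1 "Ps k" "Xs k" "\<Phi>s k i j"
        using ik that ij by simp
      show ?thesis unfolding ij prod.case by measurable
    qed
    have single: "measure (Ms k) (?E ij) \<le> 4 * exp (- (3 * L))" if "ij \<in> ?I" for ij
    proof -
      obtain i j where ij: "ij = (i, j)" by (cases ij)
      have "measure (Ms k) (?E ij) \<le> 4 * exp (- (real (ns k) * (\<tau> k)\<^sup>2 / D0))"
        unfolding ij prod.case D0_def
        by (rule jack_var_tail[OF m ik _ \<tau>0 bias]) (use that ij elim(3) in auto)
      thus ?thesis using expo by (smt (verit) exp_le_cancel_iff)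
    qed
    have "{\<omega> \<in> space (Ms k). (MAX ij\<in>?I. ?f \<omega> ij) \<ge> \<tau> k} \<subseteq> (\<Union>ij\<in>?I. ?E ij)"
    proof
      fix \<omega> assume \<omega>: "\<omega> \<in> {\<omega> \<in> space (Ms k). (MAX ij\<in>?I. ?f \<omega> ij) \<ge> \<tau> k}"
      have fin: "finite (?f \<omega> ` ?I)" "?f \<omega> ` ?I \<noteq> {}" using elim(5) by auto
      have "\<tau> k \<le> Max (?f \<omega> ` ?I)" using \<omega> by blast
      hence "\<exists>y\<in>?f \<omega> ` ?I. \<tau> k \<le> y" by (rule Max_ge_iff[OF fin, THEN iffD1])
      thus "\<omega> \<in> (\<Union>ij\<in>?I. ?E ij)" using \<omega> by blast
    qed
    hence "measure (Ms k) {\<omega> \<in> space (Ms k). (MAX ij\<in>?I. ?f \<omega> ij) \<ge> \<tau> k} \<le> measure (Ms k) (\<Union>ij\<in>?I. ?E ij)"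
      by (rule finite_measure_mono) (intro sets.finite_UN meas, auto)
    also have "\<dots> \<le> (\<Sum>ij\<in>?I. measure (Ms k) (?E ij))"
      by (rule finite_measure_subadditive_finite) (use meas in blast)+
    also have "\<dots> \<le> (\<Sum>ij\<in>?I. 4 * exp (- (3 * L)))"
      by (rule sum_mono) (rule single)
    also have "\<dots> = 4 * ((real (qs k))\<^sup>2 * exp (- (3 * L)))"
      by (simp add: card_cartesian_product power2_eq_square)
    also have "exp (- (3 * L)) = 1 / real (qs k) ^ 3"
    proof -
      have "exp (3 * L) = real (qs k) ^ 3"
        using exp_of_nat_mult[of 3 L] elim(5) by (simp add: L_def)
      thus ?thesis by (simp add: exp_minus field_simps)
    qed
    also have "4 * ((real (qs k))\<^sup>2 * (1 / real (qs k) ^ 3)) = 4 / real (qs k)"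
      using elim(5) by (simp add: power2_eq_square power3_eq_cube)
    finally show ?case by (simp add: case_prod_unfold)
  qed
  have lim: "(\<lambda>k. 4 / real (qs k)) \<longlonglongrightarrow> 0"
    by (rule filterlim_compose[OF _ qs]) real_asymp
  show ?thesis
    by (rule tendsto_sandwich[OF _ bound[unfolded \<tau>_def] tendsto_const lim]) simp
qed

theorem lemmaA1:
  fixes m :: nat
    \<comment> \<open>fixed laws and kernels; sample \<open>X 1\<close> consists of the copies of \<open>X\<close>, sample \<open>X 2\<close> of those of \<open>Y\<close>\<close>
    and M :: "'v measure" and d q :: nat and B :: real
    and P :: "nat \<Rightarrow> (nat \<Rightarrow> real) measure"
    and X :: "nat \<Rightarrow> nat \<Rightarrow> 'v \<Rightarrow> nat \<Rightarrow> real"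
    and \<Phi> :: "nat \<Rightarrow> nat \<Rightarrow> (nat \<Rightarrow> nat \<Rightarrow> real) \<Rightarrow> real"
    \<comment> \<open>asymptotic sequence, indexed by \<open>k\<close>\<close>
    and Ms :: "nat \<Rightarrow> 'w measure" and ds qs :: "nat \<Rightarrow> nat" and Bs :: real
    and ns :: "nat \<Rightarrow> nat \<Rightarrow> nat" and N :: "nat \<Rightarrow> nat"
    and Ps :: "nat \<Rightarrow> nat \<Rightarrow> (nat \<Rightarrow> real) measure"
    and Xs :: "nat \<Rightarrow> nat \<Rightarrow> nat \<Rightarrow> 'w \<Rightarrow> nat \<Rightarrow> real"
    and \<Phi>s :: "nat \<Rightarrow> nat \<Rightarrow> nat \<Rightarrow> (nat \<Rightarrow> nat \<Rightarrow> real) \<Rightarrow> real"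
    and \<epsilon> :: real and r :: "nat \<Rightarrow> real"
  assumes m: "m \<ge> 1"
  shows
    "(prob_space M \<and> kernel_family d m q B \<Phi> \<and>
      (\<forall>a\<in>{1,2}. iid_copies M d (P a) {1..} (X a))
      \<longrightarrow>
      (\<forall>a\<in>{1,2}. \<forall>i\<in>{1..q}. \<forall>j\<in>{1..q}.
         (\<lambda>n. real n * prob_space.variance M (ustat m n (\<Phi> i j) (X a)))
           \<longlonglongrightarrow> (real m)\<^sup>2 * zeta M d m (\<Phi> i j) (X a) \<and>
         tendsto_in_prob M (\<lambda>n \<omega>. real n * jack_var m n (\<Phi> i j) (X a) \<omega>)
           ((real m)\<^sup>2 * zeta M d m (\<Phi> i j) (X a))))
     \<and>
     ((\<forall>k. prob_space (Ms k) \<and> kernel_family (ds k) m (qs k) Bs (\<Phi>s k) \<and>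
        (\<forall>a\<in>{1,2}. iid_copies (Ms k) (ds k) (Ps a k) {1..ns a k} (Xs a k))) \<and>
      (\<forall>k. N k = max (ns 1 k) (ns 2 k)) \<and>
      filterlim N at_top sequentially \<and>
      filterlim qs at_top sequentially \<and>
      (\<forall>a\<in>{1,2}. (\<lambda>k. real (ns a k)) \<in> \<Theta>(\<lambda>k. real (N k))) \<and>
      0 < \<epsilon> \<and> \<epsilon> < 1/3 \<and>
      (\<lambda>k. ln (real (qs k))) \<in> O(\<lambda>k. real (N k) powr (1/3 - \<epsilon>)) \<and>
      (\<forall>a\<in>{1,2}. r a > 0 \<and>
        (\<forall>\<^sub>F k in sequentially. \<forall>i\<in>{1..qs k}. \<forall>j\<in>{1..qs k}.
           zeta (Ms k) (ds k) m (\<Phi>s k i j) (Xs a k) > r a))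
      \<longrightarrow>
      (\<exists>C>0. \<exists>eps :: nat \<Rightarrow> real. eps \<longlonglongrightarrow> 0 \<and>
        (\<forall>a\<in>{1,2}.
          (\<lambda>k. measure (Ms k) {\<omega> \<in> space (Ms k).
             (MAX (i, j)\<in>{1..qs k} \<times> {1..qs k}.
                \<bar>real (ns a k) * jack_var m (ns a k) (\<Phi>s k i j) (Xs a k) \<omega>
                 - (real m)\<^sup>2 * zeta (Ms k) (ds k) m (\<Phi>s k i j) (Xs a k)\<bar>)
             \<ge> C * (eps (N k) / ln (real (qs k)))}) \<longlonglongrightarrow> 0)))"
proof (intro conjI impI)
  assume *: "prob_space M \<and> kernel_family d m q B \<Phi> \<and> (\<forall>a\<in>{1,2}. iid_copies M d (P a) {1..} (X a))"
  have ik: "iid_kernel M d m n (max 1 B) (P a) (X a) (\<Phi> i j)"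
    if "a \<in> {1,2}" "i \<in> {1..q}" "j \<in> {1..q}" "2 * m \<le> n" for a i j n
    by (rule iid_kernelI[where q = q and I = "{1..}"]) (use * that m in auto)
  show "\<forall>a\<in>{1,2}. \<forall>i\<in>{1..q}. \<forall>j\<in>{1..q}.
      (\<lambda>n. real n * prob_space.variance M (ustat m n (\<Phi> i j) (X a)))
        \<longlonglongrightarrow> (real m)\<^sup>2 * zeta M d m (\<Phi> i j) (X a) \<and>
      tendsto_in_prob M (\<lambda>n \<omega>. real n * jack_var m n (\<Phi> i j) (X a) \<omega>)
        ((real m)\<^sup>2 * zeta M d m (\<Phi> i j) (X a))"
    by (intro ballI conjI variance_ustat_tendsto[OF m ik] jack_var_tendsto_in_prob[OF m ik])
next
  assume *: "(\<forall>k. prob_space (Ms k) \<and> kernel_family (ds k) m (qs k) Bs (\<Phi>s k) \<and>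
        (\<forall>a\<in>{1,2}. iid_copies (Ms k) (ds k) (Ps a k) {1..ns a k} (Xs a k))) \<and>
      (\<forall>k. N k = max (ns 1 k) (ns 2 k)) \<and>
      filterlim N at_top sequentially \<and>
      filterlim qs at_top sequentially \<and>
      (\<forall>a\<in>{1,2}. (\<lambda>k. real (ns a k)) \<in> \<Theta>(\<lambda>k. real (N k))) \<and>
      0 < \<epsilon> \<and> \<epsilon> < 1/3 \<and>
      (\<lambda>k. ln (real (qs k))) \<in> O(\<lambda>k. real (N k) powr (1/3 - \<epsilon>)) \<and>
      (\<forall>a\<in>{1,2}. r a > 0 \<and>
        (\<forall>\<^sub>F k in sequentially. \<forall>i\<in>{1..qs k}. \<forall>j\<in>{1..qs k}.
           zeta (Ms k) (ds k) m (\<Phi>s k i j) (Xs a k) > r a))"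
  \<comment> \<open>The witnesses are C = 1 and this sequence, common to both samples because its
    rate is expressed in \<open>N k\<close>.\<close>
  have "(\<lambda>n. real n powr (- \<epsilon>)) \<longlonglongrightarrow> 0"
    using * by (intro tendsto_neg_powr filterlim_real_sequentially) auto
  moreover have "(\<lambda>k. measure (Ms k) {\<omega> \<in> space (Ms k).
      (MAX (i, j)\<in>{1..qs k} \<times> {1..qs k}.
         \<bar>real (ns a k) * jack_var m (ns a k) (\<Phi>s k i j) (Xs a k) \<omega>
          - (real m)\<^sup>2 * zeta (Ms k) (ds k) m (\<Phi>s k i j) (Xs a k)\<bar>)
      \<ge> 1 * (real (N k) powr (- \<epsilon>) / ln (real (qs k)))}) \<longlonglongrightarrow> 0" if "a \<in> {1,2}" for a
    unfolding mult_1
    by (rule jack_var_uniform[where B = Bs and Ps = "Ps a"]) (use * that m in blast)+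
  ultimately show "\<exists>C>0. \<exists>eps :: nat \<Rightarrow> real. eps \<longlonglongrightarrow> 0 \<and>
        (\<forall>a\<in>{1,2}.
          (\<lambda>k. measure (Ms k) {\<omega> \<in> space (Ms k).
             (MAX (i, j)\<in>{1..qs k} \<times> {1..qs k}.
                \<bar>real (ns a k) * jack_var m (ns a k) (\<Phi>s k i j) (Xs a k) \<omega>
                 - (real m)\<^sup>2 * zeta (Ms k) (ds k) m (\<Phi>s k i j) (Xs a k)\<bar>)
             \<ge> C * (eps (N k) / ln (real (qs k)))}) \<longlonglongrightarrow> 0)"
    by (intro exI[of _ 1] exI[of _ "\<lambda>n. real n powr (- \<epsilon>)"] conjI ballI zero_less_one)
qed

end
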